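(* Let $G$ be a bridgeless mixed bipartite graph of order $n$ with partite sets $A$ and $B$, and let $u\in B$ be any vertex. Then (1) $\overrightarrow{\mathrm{diam}}(G)\le 2(|A|-d_G(u))+7$ if $G$ is undirected (i.e. has no directed edges), where $d_G(u)$ is the degree of $u$; (2) $\overrightarrow{\mathrm{diam}}(G)\le 2(|A|-d_G^*(u))+8$ if $d_G^+(u)+d_G^-(u)\ge 2$; (3) $\overrightarrow{\mathrm{diam}}(G)\le 2(|A|-d_G^*(u))+10$ otherwise.
   Context: A mixed graph $G$ is a finite graph whose edge set may contain both undirected edges $xy$ and directed edges $\overrightarrow{xy}$; its underlying graph (forgetting directions) is assumed simple, so between two vertices there is at most one edge, directed or undirected. $G$ is a mixed bipartite graph with partite sets $A,B$ if $V(G)$ is the disjoint union of $A$ and $B$ and every edge (directed or not) joins a vertex of $A$ and a vertex of $B$. For a vertex $x$: $d_G^+(x)$ is the number of directed edges leaving $x$, $d_G^-(x)$ the number of directed edges entering $x$, $d_G^*(x)$ the number of undirected edges incident with $x$, and $d_G(x)=d_G^+(x)+d_G^-(x)+d_G^*(x)$. An orientable path from $x_1$ to $x_k$ is a sequence of distinct vertices $x_1,\dots,x_k$ such that for each $1\le i\le k-1$ either $x_ix_{i+1}$ is an undirected edge or $\overrightarrow{x_ix_{i+1}}$ is a directed edge of $G$. $G$ is connected if for any two vertices $x,y$ there are an orientable path from $x$ to $y$ and one from $y$ to $x$. A bridge is an undirected edge whose deletion disconnects the underlying undirected graph. $G$ is bridgeless if it is connected and has no bridge. An orientation of $G$ assigns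 a direction to every undirected edge (directed edges keep their direction); it is strong if the resulting directed graph is strongly connected. The distance from $x$ to $y$ in a directed graph is the number of edges of a shortest directed path from $x$ to $y$, and the diameter is the maximum of these distances over all ordered pairs of vertices. The oriented diameter is $\overrightarrow{\mathrm{diam}}(G)=\min\{\mathrm{diam}(\overrightarrow{G}):\overrightarrow{G}\text{ is a strong orientation of }G\}$. *)

theory Defs
  imports "Graph_Theory.Graph_Theory" "HOL-Library.Extended_Nat"
begin

record 'a pre_mixed_graph =
  mverts :: "'a set"
  medges :: "'a set set"
  marcs :: "'a rel"

locale mixed_graph =
  fixes G :: "'a pre_mixed_graph"
  assumes finite_mverts: "finite (mverts G)"
    and medges_wf: "e \<in> medges G \<Longrightarrow> e \<subseteq> mverts G \<and> card e = 2"
    and marcs_wf: "(x, y) \<in> marcs G \<Longrightarrow> x \<in> mverts G \<and> y \<in> mverts G \<and> x \<noteq> y"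
    and simple_arc_arc: "(x, y) \<in> marcs G \<Longrightarrow> (y, x) \<notin> marcs G"
    and simple_edge_arc: "(x, y) \<in> marcs G \<Longrightarrow> {x, y} \<notin> medges G"

locale mixed_bipartite_graph = mixed_graph G for G :: "'a pre_mixed_graph" +
  fixes A B :: "'a set"
  assumes partition: "mverts G = A \<union> B" "A \<inter> B = {}"
    and edge_across: "{x, y} \<in> medges G \<or> (x, y) \<in> marcs G \<Longrightarrow>
      x \<in> A \<and> y \<in> B \<or> x \<in> B \<and> y \<in> A"

definition directed_part :: "'a pre_mixed_graph \<Rightarrow> 'a pair_pre_digraph" where
  "directed_part G = \<lparr> pverts = mverts G, parcs = marcs G \<rparr>"

definition mdeg_out :: "'a pre_mixed_graph \<Rightarrow> 'a \<Rightarrow> nat" where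
  "mdeg_out G x = out_degree (with_proj (directed_part G)) x"

definition mdeg_in :: "'a pre_mixed_graph \<Rightarrow> 'a \<Rightarrow> nat" where
  "mdeg_in G x = in_degree (with_proj (directed_part G)) x"

definition mdeg_und :: "'a pre_mixed_graph \<Rightarrow> 'a \<Rightarrow> nat" where
  "mdeg_und G x = card {e \<in> medges G. x \<in> e}"

definition mdeg :: "'a pre_mixed_graph \<Rightarrow> 'a \<Rightarrow> nat" where
  "mdeg G x = mdeg_out G x + mdeg_in G x + mdeg_und G x"

definition orientable_path :: "'a pre_mixed_graph \<Rightarrow> 'a \<Rightarrow> 'a list \<Rightarrow> 'a \<Rightarrow> bool" where
  "orientable_path G x p y \<longleftrightarrow>
     p \<noteq> [] \<and> set p \<subseteq> mverts G \<and> distinct p \<and> hd p = x \<and> last p = y \<and>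
     (\<forall>i. Suc i < length p \<longrightarrow>
        {p ! i, p ! Suc i} \<in> medges G \<or> (p ! i, p ! Suc i) \<in> marcs G)"

definition mconnected :: "'a pre_mixed_graph \<Rightarrow> bool" where
  "mconnected G \<longleftrightarrow>
     (\<forall>x \<in> mverts G. \<forall>y \<in> mverts G.
        (\<exists>p. orientable_path G x p y) \<and> (\<exists>p. orientable_path G y p x))"

text \<open>The underlying undirected graph is represented as a mixed graph without arcs, for which
  \<^const>\<open>mconnected\<close> is ordinary connectedness of undirected graphs.\<close>

definition underlying :: "'a pre_mixed_graph \<Rightarrow> 'a pre_mixed_graph" where
  "underlying G =
     \<lparr> mverts = mverts G, medges = medges G \<union> {{x, y} | x y. (x, y) \<in> marcs G}, marcs = {} \<rparr>"

definition delete_edge :: "'a set \<Rightarrow> 'a pre_mixed_graph \<Rightarrow> 'a pre_mixed_graph" where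
  "delete_edge e G = G \<lparr> medges := medges G - {e} \<rparr>"

definition is_bridge :: "'a pre_mixed_graph \<Rightarrow> 'a set \<Rightarrow> bool" where
  "is_bridge G e \<longleftrightarrow> e \<in> medges G \<and>
     mconnected (underlying G) \<and> \<not> mconnected (delete_edge e (underlying G))"

definition bridgeless :: "'a pre_mixed_graph \<Rightarrow> bool" where
  "bridgeless G \<longleftrightarrow> mconnected G \<and> (\<nexists>e. is_bridge G e)"

definition orientation :: "'a pre_mixed_graph \<Rightarrow> 'a pair_pre_digraph \<Rightarrow> bool" where
  "orientation G D \<longleftrightarrow>
     pverts D = mverts G \<and>
     marcs G \<subseteq> parcs D \<and>
     parcs D \<subseteq> marcs G \<union> {(x, y). {x, y} \<in> medges G} \<and>
     (\<forall>x y. {x, y} \<in> medges G \<longrightarrow> ((x, y) \<in> parcs D \<longleftrightarrow> (y, x) \<notin> parcs D))"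

definition strong_orientation :: "'a pre_mixed_graph \<Rightarrow> 'a pair_pre_digraph \<Rightarrow> bool" where
  "strong_orientation G D \<longleftrightarrow> orientation G D \<and> strongly_connected (with_proj D)"

text \<open>Distances are extended naturals, with value \<open>\<infinity>\<close> if there is no directed path. As every
  nonempty set of extended naturals has a least element, \<open>INF\<close> is a minimum unless it ranges over
  the empty set, where it is \<open>\<infinity>\<close>. In particular, a finite upper bound on
  \<open>oriented_diameter G\<close> includes the existence of a strong orientation of \<open>G\<close>.\<close>

definition digraph_dist :: "('a, 'b) pre_digraph \<Rightarrow> 'a \<Rightarrow> 'a \<Rightarrow> enat" where
  "digraph_dist D x y =
     (INF p \<in> {p. vpath p D \<and> hd p = x \<and> last p = y}. enat (vwalk_length p))"

definition digraph_diameter :: "('a, 'b) pre_digraph \<Rightarrow> enat" where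
  "digraph_diameter D = (SUP x \<in> verts D. SUP y \<in> verts D. digraph_dist D x y)"

definition oriented_diameter :: "'a pre_mixed_graph \<Rightarrow> enat" where
  "oriented_diameter G = (INF D \<in> {D. strong_orientation G D}. digraph_diameter (with_proj D))"

text \<open>By the following facts the natural-number subtractions \<open>card A - mdeg_und G u\<close> and
  \<open>card A - mdeg G u\<close> (the latter in the absence of arcs) are never truncated for \<open>u \<in> B\<close>.\<close>

lemma (in mixed_bipartite_graph) mdeg_und_le_card:
  assumes "u \<in> B"
  shows "mdeg_und G u \<le> card A"
proof -
  have "{e \<in> medges G. u \<in> e} \<subseteq> (\<lambda>a. {u, a}) ` A"
  proof
    fix e assume "e \<in> {e \<in> medges G. u \<in> e}"
    then have e: "e \<in> medges G" "u \<in> e" by auto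
    from medges_wf[OF e(1)] obtain x y where xy: "e = {x, y}"
      by (auto simp: card_2_iff)
    with e obtain a where a: "e = {u, a}" by auto
    with e edge_across[of u a] assms partition have "a \<in> A" by auto
    with a show "e \<in> (\<lambda>a. {u, a}) ` A" by auto
  qed
  moreover have "finite A" using finite_mverts partition by simp
  ultimately show ?thesis
    unfolding mdeg_und_def by (rule surj_card_le[rotated])
qed

lemma mdeg_eq_mdeg_und:
  assumes "marcs G = {}"
  shows "mdeg G u = mdeg_und G u"
  using assms
  by (simp add: mdeg_def mdeg_out_def mdeg_in_def out_degree_def in_degree_def
      out_arcs_def in_arcs_def directed_part_def)

end

theory Submission
  imports Defs
begin

text \<open>
  A graph is treated as the relation of its possible directions: an undirected edge contributes
  two opposite pairs, a directed edge one. To orient it is to discard one pair of every opposite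
  two.

  The vertices of a path alternate between \<open>A\<close> and \<open>B\<close>, so a path with \<open>k\<close> vertices in \<open>A\<close>
  has length at most \<open>2 * k\<close>, and at most \<open>2 * k - 1\<close> if one of its ends lies in \<open>A\<close>
  (\<open>alternating_length\<close>). Let \<open>N\<close> be the set of the \<open>d\<close> vertices joined to \<open>u\<close> by undirected
  edges. A walk that meets only \<open>j\<close> of them has at most \<open>card A - d + j\<close> vertices in \<open>A\<close>.
  It therefore suffices to orient the graph so that any two vertices are joined by a walk that
  meets few vertices of \<open>N\<close>.

  Each edge at \<open>u\<close> is directed towards \<open>u\<close> or away from \<open>u\<close>, which splits \<open>N\<close> into a part
  \<open>Nm\<close> (towards \<open>u\<close>) and the rest. Any walk can be rerouted through \<open>u\<close> between its first and
  its last visit to \<open>N \<union> {u}\<close>. The price is the number of vertices of \<open>N\<close> on a route to \<open>u\<close>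
  and on a route from \<open>u\<close>; such routes are composed of links, that is, of walks whose inner
  vertices lie outside \<open>N \<union> {u}\<close>. An extremal choice of \<open>Nm\<close> (\<open>two_colouring\<close>) provides routes
  with at most three vertices of \<open>N\<close> towards \<open>u\<close> and at most two from \<open>u\<close>. Every vertex \<open>v\<close>
  has at least one link to start with, because the edge between \<open>u\<close> and \<open>v\<close> is not a bridge.

  All these links have to survive in one strong orientation (\<open>orientation_with_links\<close>). Edges
  are oriented one by one. For strong connectivity this is the argument of Boesch and Tindell: an
  edge that is not a bridge can be directed in one of the two ways. Two links that need the same
  edge in opposite directions can exchange their tails; the new links avoid the edge, and the
  requirements are chosen such that one of the new links serves as well as an old one.

  This gives the bound with \<open>10\<close>. If at least two directed edges are incident with \<open>u\<close>, a walk
  with five vertices of \<open>N\<close> can be arranged to miss an end of one of these directed edges, a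
  further vertex of \<open>A\<close>, which gives \<open>8\<close> (\<open>mixed_routes\<close>). In an undirected graph links can be
  reversed. Then \<open>Nm\<close> is taken as a maximal set without links inside it, and two vertices of
  \<open>N\<close> suffice in either direction. Of the resulting \<open>8\<close> one more is gained: either the fourth
  vertex of \<open>N\<close> is needed only for walks that end in \<open>A\<close>, or some walks have only three
  vertices of \<open>N\<close> and all others avoid a part of the graph that is attached to a single vertex
  of \<open>N\<close> and contains a vertex of \<open>A\<close>.
\<close>

section \<open>Walks that avoid a set of vertices\<close>

definition inner :: "'a set \<Rightarrow> 'a rel \<Rightarrow> 'a rel" where
  "inner Z C = {(x, y) \<in> C. x \<notin> Z \<and> y \<notin> Z}"

definition reach :: "'a set \<Rightarrow> 'a rel \<Rightarrow> 'a \<Rightarrow> 'a \<Rightarrow> bool" where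
  "reach Z C x y \<longleftrightarrow> x \<notin> Z \<and> (x, y) \<in> (inner Z C)\<^sup>*"

text \<open>
  The end \<open>q\<close> of \<open>enters\<close>, the end \<open>p\<close> of \<open>leaves\<close> and both ends of \<open>link\<close> are exempt from
  avoiding \<open>Z\<close>; in the applications they lie in \<open>Z\<close>. A link has an inner vertex, so an arc from
  \<open>p\<close> to \<open>q\<close> alone is not a link.
\<close>

definition enters :: "'a set \<Rightarrow> 'a rel \<Rightarrow> 'a \<Rightarrow> 'a \<Rightarrow> bool" where
  "enters Z C x q \<longleftrightarrow> (\<exists>b. reach Z C x b \<and> (b, q) \<in> C)"

definition leaves :: "'a set \<Rightarrow> 'a rel \<Rightarrow> 'a \<Rightarrow> 'a \<Rightarrow> bool" where
  "leaves Z C p y \<longleftrightarrow> (\<exists>a. (p, a) \<in> C \<and> reach Z C a y)"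

definition link :: "'a set \<Rightarrow> 'a rel \<Rightarrow> 'a \<Rightarrow> 'a \<Rightarrow> bool" where
  "link Z C p q \<longleftrightarrow> (\<exists>a. (p, a) \<in> C \<and> enters Z C a q)"

lemma reach_refl: "x \<notin> Z \<Longrightarrow> reach Z C x x"
  by (simp add: reach_def)

lemma reach_step: "(x, y) \<in> C \<Longrightarrow> x \<notin> Z \<Longrightarrow> y \<notin> Z \<Longrightarrow> reach Z C x y"
  by (auto simp: reach_def inner_def)

lemma reach_trans: "reach Z C x y \<Longrightarrow> reach Z C y z \<Longrightarrow> reach Z C x z"
  by (auto simp: reach_def)

lemma reach_source: "reach Z C x y \<Longrightarrow> x \<notin> Z"
  by (simp add: reach_def)

lemma reach_target: "reach Z C x y \<Longrightarrow> y \<notin> Z"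
  unfolding reach_def by (auto elim: rtranclE simp: inner_def)

lemma reach_mono: "reach Z C x y \<Longrightarrow> Z' \<subseteq> Z \<Longrightarrow> C \<subseteq> C' \<Longrightarrow> reach Z' C' x y"
  unfolding reach_def inner_def
  by (auto elim!: rtrancl_mono[THEN subsetD, rotated])

lemma reach_empty: "reach {} C x y \<longleftrightarrow> (x, y) \<in> C\<^sup>*"
  by (simp add: reach_def inner_def)

lemma reach_converse: "reach Z (C\<inverse>) x y \<longleftrightarrow> reach Z C y x"
proof -
  have "inner Z (C\<inverse>) = (inner Z C)\<inverse>" by (auto simp: inner_def)
  then show ?thesis
    using reach_target[of Z C y x] reach_target[of Z "C\<inverse>" x y]
    by (auto simp: reach_def rtrancl_converse)
qed

lemma enters_mono: "enters Z C x q \<Longrightarrow> Z' \<subseteq> Z \<Longrightarrow> C \<subseteq> C' \<Longrightarrow> enters Z' C' x q"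
  unfolding enters_def by (meson reach_mono subsetD)

lemma leaves_mono: "leaves Z C p y \<Longrightarrow> Z' \<subseteq> Z \<Longrightarrow> C \<subseteq> C' \<Longrightarrow> leaves Z' C' p y"
  unfolding leaves_def by (meson reach_mono subsetD)

lemma link_mono: "link Z C p q \<Longrightarrow> Z' \<subseteq> Z \<Longrightarrow> C \<subseteq> C' \<Longrightarrow> link Z' C' p q"
  unfolding link_def by (meson enters_mono subsetD)

lemma link_converse: "link Z (C\<inverse>) p q \<longleftrightarrow> link Z C q p"
  unfolding link_def enters_def reach_converse converse_iff by blast

lemma reach_enters: "reach Z C x y \<Longrightarrow> enters Z C y q \<Longrightarrow> enters Z C x q"
  unfolding enters_def by (meson reach_trans)

lemma leaves_reach: "leaves Z C p x \<Longrightarrow> reach Z C x y \<Longrightarrow> leaves Z C p y"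
  unfolding leaves_def by (meson reach_trans)

lemma leaves_enters: "leaves Z C p x \<Longrightarrow> enters Z C x q \<Longrightarrow> link Z C p q"
  unfolding leaves_def link_def by (meson reach_enters)

lemma link_leaves: "link Z C p q \<longleftrightarrow> (\<exists>b. leaves Z C p b \<and> (b, q) \<in> C)"
  unfolding leaves_def link_def enters_def by blast

lemma entersI: "x \<notin> Z \<Longrightarrow> (x, q) \<in> C \<Longrightarrow> enters Z C x q"
  unfolding enters_def by (meson reach_refl)

lemma leavesI: "y \<notin> Z \<Longrightarrow> (p, y) \<in> C \<Longrightarrow> leaves Z C p y"
  unfolding leaves_def by (meson reach_refl)

lemma enters_reach:
  assumes "enters Z C x q" "Av \<subseteq> Z" "q \<notin> Av" shows "reach Av C x q"
proof -
  from assms obtain b where b: "reach Z C x b" "(b, q) \<in> C" unfolding enters_def by blast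
  with assms have "reach Av C x b" "b \<notin> Z" using reach_mono[OF b(1) _ subset_refl] reach_target[OF b(1)] by auto
  then show ?thesis using reach_step[OF b(2), of Av] assms by (meson reach_trans subsetD)
qed

lemma reach_leaves:
  assumes "leaves Z C p y" "Av \<subseteq> Z" "p \<notin> Av" shows "reach Av C p y"
proof -
  from assms obtain b where b: "reach Z C b y" "(p, b) \<in> C" unfolding leaves_def by blast
  with assms have "reach Av C b y" "b \<notin> Z" using reach_mono[OF b(1) _ subset_refl] reach_source[OF b(1)] by auto
  then show ?thesis using reach_step[OF b(2), of Av] assms by (meson reach_trans subsetD)
qed

lemma link_reach:
  assumes "link Z C p q" "Av \<subseteq> Z" "p \<notin> Av" "q \<notin> Av" shows "reach Av C p q"
proof -
  from assms obtain b where b: "enters Z C b q" "(p, b) \<in> C" unfolding link_def by blast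
  with assms have "reach Av C b q" "b \<notin> Av"
    using enters_reach[OF b(1)] reach_source[of Av C b q] by auto
  then show ?thesis using reach_step[OF b(2), of Av] assms by (meson reach_trans subsetD)
qed

lemma link_rtrancl: "link Z C p q \<Longrightarrow> (p, q) \<in> C\<^sup>*"
  using link_reach[of Z C p q "{}"] by (simp add: reach_empty)

text \<open>
  The second alternative is the useful one. To see that a walk can be kept away from \<open>T\<close>, it is
  cut at a vertex of \<open>T\<close>, and then one of the halves is impossible or opens a shorter route.
\<close>

lemma reach_avoid:
  assumes "reach Z C x y"
  shows "reach (Z \<union> T) C x y \<or> (\<exists>t\<in>T - Z. reach Z C x t \<and> reach Z C t y)"
proof -
  have x: "x \<notin> Z" and "(x, y) \<in> (inner Z C)\<^sup>*" using assms by (auto simp: reach_def)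
  from this(2) show ?thesis
  proof (induction rule: rtrancl_induct)
    case base
    then show ?case using x reach_refl[of x] by blast
  next
    case (step y z)
    then have r: "reach Z C x y" and yz: "(y, z) \<in> C" "y \<notin> Z" "z \<notin> Z"
      using x by (auto simp: reach_def inner_def)
    have "reach Z C y z" by (rule reach_step[OF yz])
    show ?case
    proof (cases "z \<in> T")
      case True
      then show ?thesis using yz reach_trans[OF r \<open>reach Z C y z\<close>] reach_refl[of z Z C] by blast
    next
      case False
      from step.IH show ?thesis
      proof
        assume a: "reach (Z \<union> T) C x y"
        then have "y \<notin> Z \<union> T" by (rule reach_target)
        then have "reach (Z \<union> T) C y z" using yz False by (intro reach_step) auto
        then show ?thesis using reach_trans[OF a] by blast
      next
        assume "\<exists>t\<in>T - Z. reach Z C x t \<and> reach Z C t y"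
        then show ?thesis by (meson \<open>reach Z C y z\<close> reach_trans)
      qed
    qed
  qed
qed

lemma enters_avoid:
  "enters Z C x q \<Longrightarrow> enters (Z \<union> T) C x q \<or> (\<exists>t\<in>T - Z. reach Z C x t \<and> enters Z C t q)"
  unfolding enters_def by (meson reach_avoid)

lemma leaves_avoid:
  "leaves Z C p y \<Longrightarrow> leaves (Z \<union> T) C p y \<or> (\<exists>t\<in>T - Z. leaves Z C p t \<and> reach Z C t y)"
  unfolding leaves_def by (meson reach_avoid)

lemma link_avoid:
  "link Z C p q \<Longrightarrow> link (Z \<union> T) C p q \<or> (\<exists>t\<in>T - Z. leaves Z C p t \<and> enters Z C t q)"
  unfolding link_leaves enters_def by (meson leaves_avoid)

text \<open>
  For out-neighbours \<open>T\<close> of a vertex: a walk from that vertex may start with the last member of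
  \<open>T\<close> that it meets, and then it meets no other one.
\<close>

lemma reach_last:
  assumes "reach Z C x y" "x \<in> T"
  shows "\<exists>s\<in>T. s \<notin> Z \<and> reach Z C x s \<and> reach (Z \<union> (T - {s})) C s y"
proof -
  have x: "x \<notin> Z" and "(x, y) \<in> (inner Z C)\<^sup>*" using assms by (auto simp: reach_def)
  from this(2) show ?thesis
  proof (induction rule: rtrancl_induct)
    case base
    then show ?case using x assms(2) by (auto intro!: bexI[of _ x] reach_refl)
  next
    case (step y z)
    then have yz: "(y, z) \<in> C" "y \<notin> Z" "z \<notin> Z" by (auto simp: inner_def)
    obtain s where s: "s \<in> T" "s \<notin> Z" "reach Z C x s" "reach (Z \<union> (T - {s})) C s y"
      using step.IH by blast
    show ?case
    proof (cases "z \<in> T")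
      case True
      have "reach Z C x y" using s reach_mono[OF s(4), of Z C] reach_trans by (metis Un_upper1 subset_refl)
      then have "reach Z C x z" using reach_step[OF yz] by (rule reach_trans)
      then show ?thesis using True yz by (auto intro!: bexI[of _ z] reach_refl)
    next
      case False
      have "reach (Z \<union> (T - {s})) C y z"
        using yz False reach_target[OF s(4)] by (intro reach_step) auto
      then show ?thesis using s reach_trans[OF s(4)] by blast
    qed
  qed
qed

lemma first_visit:
  assumes "(x, z) \<in> C\<^sup>*" "z \<in> Z" "x \<notin> Z"
  shows "\<exists>h\<in>Z. enters Z C x h"
  using assms
proof (induction rule: converse_rtrancl_induct)
  case (step x y)
  then show ?case
    by (meson entersI reach_enters reach_step)
qed simp

lemma last_visit:
  assumes "(z, y) \<in> C\<^sup>*" "z \<in> Z" "y \<notin> Z"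
  shows "\<exists>h\<in>Z. leaves Z C h y"
  using assms
proof (induction rule: rtrancl_induct)
  case (step x y)
  show ?case
  proof (cases "x \<in> Z")
    case True
    then show ?thesis by (meson step.hyps step.prems leavesI)
  next
    case False
    then obtain h where "h \<in> Z" "leaves Z C h x" using step by blast
    then show ?thesis by (meson leaves_reach reach_step step.hyps step.prems False)
  qed
qed simp

section \<open>Orienting undirected edges\<close>

text \<open>
  At least one direction of every edge is kept, so only undirected edges, which are pairs of
  opposite arcs, can lose a direction. The orientation is complete if also \<open>D \<inter> D\<inverse> = {}\<close>.
\<close>

definition orients :: "'a rel \<Rightarrow> 'a rel \<Rightarrow> bool" where
  "orients D C \<longleftrightarrow> D \<subseteq> C \<and> D \<union> D\<inverse> = C \<union> C\<inverse>"

lemma orients_trans: "orients D C \<Longrightarrow> orients C B \<Longrightarrow> orients D B"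
  unfolding orients_def by (metis order_trans)

lemma orients_remove:
  assumes "(x, y) \<in> C" "(y, x) \<in> C" "x \<noteq> y"
  shows "orients (C - {(y, x)}) C"
  unfolding orients_def using assms by blast

text \<open>
  Keep the part of the walk before the first and the part after the last use of the edge between
  \<open>x\<close> and \<open>y\<close>.
\<close>

lemma rtrancl_two_ends:
  assumes "(a, b) \<in> R\<^sup>*" and R': "R' = R - {(x, y), (y, x)}"
  shows "(a, b) \<in> R'\<^sup>* \<or>
    ((a, x) \<in> R'\<^sup>* \<or> (a, y) \<in> R'\<^sup>*) \<and> ((x, b) \<in> R'\<^sup>* \<or> (y, b) \<in> R'\<^sup>*)"
  using assms(1)
proof (induction rule: rtrancl_induct)
  case (step b c)
  show ?case
  proof (cases "(b, c) \<in> R'")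
    case True
    then have "(s, b) \<in> R'\<^sup>* \<Longrightarrow> (s, c) \<in> R'\<^sup>*" for s
      by (metis rtrancl.rtrancl_into_rtrancl)
    then show ?thesis using step.IH by blast
  next
    case False
    then have "(b = x \<and> c = y) \<or> (b = y \<and> c = x)" using step R' by auto
    then show ?thesis using step.IH by auto
  qed
qed simp

text \<open>
  The local step of the theorem of Boesch and Tindell on strong orientations of mixed graphs.
  Let \<open>X\<close> be the set of vertices that can be reached from \<open>x\<close> without the edge, and suppose that
  \<open>y\<close> is not among them. As the edge is not a bridge, another edge joins some \<open>a\<close> in \<open>X\<close> to some
  \<open>b\<close> outside, and it can only be directed from \<open>b\<close> to \<open>a\<close>. Now \<open>b\<close> is reached from \<open>y\<close>, and
  \<open>x\<close> from \<open>a\<close>, without the edge.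
\<close>

lemma strong_edge_detour:
  assumes strong: "V \<times> V \<subseteq> C\<^sup>*" and CV: "C \<subseteq> V \<times> V"
    and xy: "(x, y) \<in> C" "(y, x) \<in> C"
    and nobridge: "(x, y) \<in> ((C \<union> C\<inverse>) - {(x, y), (y, x)})\<^sup>*"
  defines "C' \<equiv> C - {(x, y), (y, x)}"
  shows "(x, y) \<in> C'\<^sup>* \<or> (y, x) \<in> C'\<^sup>*"
proof (rule ccontr)
  assume no: "\<not> ?thesis"
  have C'_eq: "C' = C - {(x, y), (y, x)}" by (simp add: C'_def)
  define X where "X = {z. (x, z) \<in> C'\<^sup>*}"
  have xX: "x \<in> X" and yX: "y \<notin> X" using no by (auto simp: X_def)
  have "\<exists>a b. (a, b) \<in> R \<and> a \<in> X \<and> b \<notin> X" if "(x, z) \<in> R\<^sup>*" "z \<notin> X" for R z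
    using that xX by (induction rule: rtrancl_induct) blast+
  from this[OF nobridge yX] obtain a b
    where ab: "a \<in> X" "b \<notin> X" "(a, b) \<in> (C \<union> C\<inverse>) - {(x, y), (y, x)}"
    by blast
  have "(a, b) \<notin> C'" using ab(1,2) by (auto simp: X_def intro: rtrancl.rtrancl_into_rtrancl)
  then have ba: "(b, a) \<in> C'" using ab(3) by (auto simp: C'_def)
  then have V: "a \<in> V" "b \<in> V" "x \<in> V" "y \<in> V" using CV xy by (auto simp: C'_def)
  have "(x, b) \<in> C\<^sup>*" "(a, x) \<in> C\<^sup>*" using strong V by auto
  have yb: "(y, b) \<in> C'\<^sup>*"
    using rtrancl_two_ends[OF \<open>(x, b) \<in> C\<^sup>*\<close> C'_eq] ab(2) by (simp add: X_def)
  have "(a, x) \<in> C'\<^sup>*"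
    using rtrancl_two_ends[OF \<open>(a, x) \<in> C\<^sup>*\<close> C'_eq] ab(1) yX rtrancl_trans[of x a C' y]
    by (simp add: X_def) blast
  then have "(y, x) \<in> C'\<^sup>*" using yb ba by (meson rtrancl_trans r_into_rtrancl)
  then show False using no by blast
qed

text \<open>
  A pair \<open>(P, Q)\<close> is read as the demand that some vertex of \<open>P\<close> be linked to some vertex of \<open>Q\<close>.
\<close>

definition sat :: "'a set \<Rightarrow> 'a rel \<Rightarrow> 'a set \<times> 'a set \<Rightarrow> bool" where
  "sat Z C d \<longleftrightarrow> (\<exists>p\<in>fst d. \<exists>q\<in>snd d. link Z C p q)"

text \<open>
  The link uses the discarded arc from \<open>y\<close> to \<open>x\<close>, and a shortcut shows that the part before
  this arc and the part after it use the edge in neither direction. Only a closed link at an end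
  of the edge can be forced to use both directions; the hypothesis on \<open>p = q\<close> excludes it.
\<close>

lemma link_broken:
  assumes l: "link Z C p q" and br: "\<not> link Z (C - {(y, x)}) p q"
    and pq: "p \<in> Z" "q \<in> Z" "p = q \<Longrightarrow> p \<noteq> x \<and> p \<noteq> y" and xyZ: "x \<notin> Z \<or> y \<notin> Z"
    and xy: "(x, y) \<in> C"
  defines "C' \<equiv> C - {(x, y), (y, x)}"
  shows "(p = y \<or> leaves Z C' p y) \<and> (x = q \<or> enters Z C' x q)"
proof -
  from l obtain a b where ab: "(p, a) \<in> C" "reach Z C a b" "(b, q) \<in> C"
    unfolding link_def enters_def by blast
  then have aZ: "a \<notin> Z" "b \<notin> Z" by (simp_all add: reach_source reach_target)
  have brk: False if "(p, a') \<in> C - {(y, x)}" "reach Z (C - {(y, x)}) a' b'" "(b', q) \<in> C - {(y, x)}"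
    for a' b' using that br unfolding link_def enters_def by blast
  have sub: "C' \<subseteq> C - {(y, x)}" by (auto simp: C'_def)
  consider "x \<notin> Z" "y \<notin> Z" | "x \<in> Z" "y \<notin> Z" | "x \<notin> Z" "y \<in> Z" using xyZ by blast
  then show ?thesis
  proof cases
    case 1
    have pa: "(p, a) \<in> C'" and bq: "(b, q) \<in> C'" using ab 1 pq by (auto simp: C'_def)
    have i: "inner Z C' = inner Z C - {(x, y), (y, x)}" by (auto simp: inner_def C'_def)
    have "(a, b) \<in> (inner Z C)\<^sup>*" using ab by (simp add: reach_def)
    from rtrancl_two_ends[OF this i]
    have r: "reach Z C' a b \<or> (reach Z C' a x \<or> reach Z C' a y) \<and> (reach Z C' x b \<or> reach Z C' y b)"
      using aZ 1 by (auto simp: reach_def)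
    have up: "reach Z C' s t \<Longrightarrow> reach Z (C - {(y, x)}) s t" for s t
      by (rule reach_mono[OF _ subset_refl sub])
    have nn: "\<not> reach Z (C - {(y, x)}) a b" using brk[of a b] pa bq sub by blast
    have st: "reach Z (C - {(y, x)}) x y"
      using 1 xy by (cases "x = y") (auto intro: reach_step reach_refl)
    have "\<not> reach Z C' a b" using up nn by blast
    moreover have "\<not> (reach Z C' a x \<and> reach Z C' x b)" by (meson up nn reach_trans)
    moreover have "\<not> (reach Z C' a y \<and> reach Z C' y b)" by (meson up nn reach_trans)
    moreover have "\<not> (reach Z C' a x \<and> reach Z C' y b)"
      by (meson up nn st reach_trans)
    ultimately have "reach Z C' a y \<and> reach Z C' x b" using r by blast
    then show ?thesis using pa bq unfolding leaves_def enters_def by blast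
  next
    case 2
    have i: "inner Z C' = inner Z C" "inner Z (C - {(y, x)}) = inner Z C"
      using 2 by (auto simp: inner_def C'_def)
    then have "(b, q) = (y, x)" using brk ab aZ 2 pq by (auto simp: reach_def)
    then show ?thesis using ab pq 2 i unfolding leaves_def by (auto simp: reach_def C'_def)
  next
    case 3
    have i: "inner Z C' = inner Z C" "inner Z (C - {(y, x)}) = inner Z C"
      using 3 by (auto simp: inner_def C'_def)
    then have "(p, a) = (y, x)" using brk ab aZ 3 pq by (auto simp: reach_def)
    then show ?thesis using ab pq 3 i unfolding enters_def by (auto simp: reach_def C'_def)
  qed
qed

lemma link_join:
  assumes "p = y \<or> leaves Z C p y" "y = q \<or> enters Z C y q" "p \<in> Z" "q \<in> Z"
  shows "link Z C p q \<or> p = q \<and> p = y"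
proof -
  have "leaves Z C p y \<Longrightarrow> y \<notin> Z" "enters Z C y q \<Longrightarrow> y \<notin> Z"
    by (auto simp: leaves_def enters_def dest: reach_target reach_source)
  then show ?thesis using assms by (metis leaves_enters)
qed

lemma sat_mono: "sat Z C d \<Longrightarrow> C \<subseteq> C' \<Longrightarrow> sat Z C' d"
  unfolding sat_def by (meson link_mono subset_refl)

lemma strong_remove:
  assumes "V \<times> V \<subseteq> C\<^sup>*" and "(y, x) \<in> (C - {(y, x)})\<^sup>*"
  shows "V \<times> V \<subseteq> (C - {(y, x)})\<^sup>*"
proof -
  have "C \<subseteq> (C - {(y, x)})\<^sup>*" using assms(2) by auto
  then have "C\<^sup>* \<subseteq> (C - {(y, x)})\<^sup>*" by (rule rtrancl_subset_rtrancl)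
  then show ?thesis using assms(1) by blast
qed

text \<open>
  A smallest partial orientation of \<open>C0\<close> that is strong and meets all demands has no undirected
  edge left. Suppose that both directions of an edge between \<open>x\<close> and \<open>y\<close> are
  present. If each of them is needed by some demand, the links concerned run through the edge in
  opposite directions, and exchanging their tails contradicts \<open>uncross\<close>; the case \<open>p1 = q2\<close>
  there arises when the common vertex of the exchanged parts lies in \<open>Z\<close>. If no demand needs the
  direction from \<open>b\<close> to \<open>a\<close>, it must be needed for strong connectivity. Then, by
  \<open>strong_edge_detour\<close>, the other direction is needed by a demand. The part of its link behind the
  edge, a walk back from the end of the link to its start (\<open>span\<close>), and the part before the edge
  lead from \<open>b\<close> to \<open>a\<close> without the direction from \<open>b\<close> to \<open>a\<close>.
\<close>

lemma orientation_with_links: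
  fixes C0 :: "'a rel" and V Z :: "'a set" and Dm :: "('a set \<times> 'a set) set"
  assumes fin: "finite V" and CV: "C0 \<subseteq> V \<times> V" and irr: "\<And>x. (x, x) \<notin> C0"
    and strong: "V \<times> V \<subseteq> C0\<^sup>*"
    and nobridge: "\<And>x y. (x, y) \<in> C0 \<Longrightarrow> (y, x) \<in> C0 \<Longrightarrow>
      (x, y) \<in> ((C0 \<union> C0\<inverse>) - {(x, y), (y, x)})\<^sup>*"
    and ZZ: "\<And>x y. (x, y) \<in> C0 \<Longrightarrow> (y, x) \<in> C0 \<Longrightarrow> x \<notin> Z \<or> y \<notin> Z"
    and dm: "\<And>P Q. (P, Q) \<in> Dm \<Longrightarrow> P \<subseteq> Z \<and> Q \<subseteq> Z"
    and loop: "\<And>P Q p y. (P, Q) \<in> Dm \<Longrightarrow> p \<in> P \<Longrightarrow> p \<in> Q \<Longrightarrow> (p, y) \<in> C0 \<Longrightarrow> (y, p) \<notin> C0"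
    and sat0: "\<And>d. d \<in> Dm \<Longrightarrow> sat Z C0 d"
    and span: "\<And>C. orients C C0 \<Longrightarrow> \<forall>d\<in>Dm. sat Z C d \<Longrightarrow> Z \<times> Z \<subseteq> C\<^sup>*"
    and uncross: "\<And>C P1 Q1 P2 Q2 p1 q1 p2 q2. C \<subseteq> C0 \<Longrightarrow> (P1, Q1) \<in> Dm \<Longrightarrow> (P2, Q2) \<in> Dm \<Longrightarrow>
      p1 \<in> P1 \<Longrightarrow> q1 \<in> Q1 \<Longrightarrow> p2 \<in> P2 \<Longrightarrow> q2 \<in> Q2 \<Longrightarrow>
      link Z C p1 q2 \<or> p1 = q2 \<and> (\<exists>y. (p1, y) \<in> C0 \<and> (y, p1) \<in> C0) \<Longrightarrow>
      link Z C p2 q1 \<or> p2 = q1 \<and> (\<exists>y. (p2, y) \<in> C0 \<and> (y, p2) \<in> C0) \<Longrightarrow>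
      sat Z C (P1, Q1) \<or> sat Z C (P2, Q2)"
  obtains D where "orients D C0" "D \<inter> D\<inverse> = {}" "V \<times> V \<subseteq> D\<^sup>*" "\<forall>d\<in>Dm. sat Z D d"
proof -
  define ok where "ok C \<longleftrightarrow> orients C C0 \<and> V \<times> V \<subseteq> C\<^sup>* \<and> (\<forall>d\<in>Dm. sat Z C d)" for C
  have "ok C0" using strong sat0 by (auto simp: ok_def orients_def)
  then have "\<exists>C. ok C \<and> (\<forall>C'. ok C' \<longrightarrow> card C \<le> card C')"
    by (rule ex_has_least_nat[of ok C0 card])
  then obtain D where D: "ok D" and minD: "\<And>C. ok C \<Longrightarrow> card D \<le> card C" by blast
  have D0: "orients D C0" "V \<times> V \<subseteq> D\<^sup>*" "\<forall>d\<in>Dm. sat Z D d" using D by (auto simp: ok_def)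
  have DC: "D \<subseteq> C0" and DD: "D \<union> D\<inverse> = C0 \<union> C0\<inverse>" using D0(1) by (auto simp: orients_def)
  have finD: "finite D" using DC CV fin by (meson finite_SigmaI finite_subset)
  have False if xyD: "(x, y) \<in> D" "(y, x) \<in> D" for x y
  proof -
    define E where "E = D - {(x, y), (y, x)}"
    have xyC: "(x, y) \<in> C0" "(y, x) \<in> C0" "x \<noteq> y" using xyD DC irr by auto
    have E_sub: "E \<subseteq> D - {(x, y)}" "E \<subseteq> D - {(y, x)}" by (auto simp: E_def)
    have o1: "orients (D - {(y, x)}) C0" and o2: "orients (D - {(x, y)}) C0"
      using orients_trans[OF orients_remove D0(1)] xyD xyC by auto
    have nok: "\<not> ok (D - {e})" if "e \<in> D" for e
      using minD[of "D - {e}"] card_Diff1_less[OF finD that] by auto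
    (* The two parts of a link that is destroyed by discarding the arc from b to a, where a and b
       are x and y in either order. *)
    have ends: "(p = b \<or> leaves Z E p b) \<and> (a = q \<or> enters Z E a q)"
      if "(P, Q) \<in> Dm" "p \<in> P" "q \<in> Q" "link Z D p q" "\<not> sat Z (D - {(b, a)}) (P, Q)"
        "(a, b) = (x, y) \<or> (a, b) = (y, x)" for P Q p q a b
    proof -
      have "\<not> link Z (D - {(b, a)}) p q" using that by (auto simp: sat_def)
      moreover have "D - {(a, b), (b, a)} = E" using that(6) by (auto simp: E_def)
      moreover have "p \<in> Z" "q \<in> Z" using dm[OF that(1)] that by auto
      moreover have "p = q \<Longrightarrow> p \<noteq> a \<and> p \<noteq> b"
        using loop[OF that(1,2), of x] loop[OF that(1,2), of y] that(3,6) xyC by auto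
      moreover have "a \<notin> Z \<or> b \<notin> Z" using ZZ that(6) xyC by auto
      moreover have "(a, b) \<in> D" using that(6) xyD by auto
      ultimately show ?thesis using link_broken[OF that(4), of b a] by metis
    qed
    (* Each direction of the edge is needed by a demand. *)
    have no_both: False if d1: "d1 \<in> Dm" "\<not> sat Z (D - {(y, x)}) d1"
      and d2: "d2 \<in> Dm" "\<not> sat Z (D - {(x, y)}) d2" for d1 d2
    proof -
      obtain P1 Q1 P2 Q2 where P: "d1 = (P1, Q1)" "d2 = (P2, Q2)" by fastforce
      have "sat Z D d1" "sat Z D d2" using D0 d1 d2 by auto
      then obtain p1 q1 p2 q2 where
        l: "p1 \<in> P1" "q1 \<in> Q1" "link Z D p1 q1" "p2 \<in> P2" "q2 \<in> Q2" "link Z D p2 q2"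
        unfolding sat_def P by auto
      have e1: "(p1 = y \<or> leaves Z E p1 y)" "(x = q1 \<or> enters Z E x q1)"
        using ends[of P1 Q1 p1 q1 y x] l d1 P by auto
      have e2: "(p2 = x \<or> leaves Z E p2 x)" "(y = q2 \<or> enters Z E y q2)"
        using ends[of P2 Q2 p2 q2 x y] l d2 P by auto
      have inZ: "p1 \<in> Z" "q1 \<in> Z" "p2 \<in> Z" "q2 \<in> Z"
        using dm l d1(1) d2(1) P by blast+
      have c1: "link Z E p1 q2 \<or> p1 = q2 \<and> p1 = y" using link_join[OF e1(1) e2(2)] inZ by blast
      have c2: "link Z E p2 q1 \<or> p2 = q1 \<and> p2 = x" using link_join[OF e2(1) e1(2)] inZ by blast
      have "sat Z E (P1, Q1) \<or> sat Z E (P2, Q2)"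
        by (rule uncross[of E P1 Q1 P2 Q2 p1 q1 p2 q2]) (use c1 c2 l d1 d2 P E_sub DC xyC in auto)
      then show False
        using sat_mono[OF _ E_sub(1)] sat_mono[OF _ E_sub(2)] d1(2) d2(2) P by auto
    qed
    (* Every demand can do without the arc from b to a. *)
    have one_way: False
      if ab: "(a, b) = (x, y) \<or> (a, b) = (y, x)"
        and all: "\<forall>d\<in>Dm. sat Z (D - {(b, a)}) d" for a b
    proof -
      have abD: "(a, b) \<in> D" "(b, a) \<in> D" using ab xyD by auto
      have EE: "E = D - {(a, b), (b, a)}" using ab by (auto simp: E_def)
      have o: "orients (D - {(b, a)}) C0" "orients (D - {(a, b)}) C0" using ab o1 o2 by auto
      have "\<not> V \<times> V \<subseteq> (D - {(b, a)})\<^sup>*"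
        using nok[OF abD(2)] all o by (auto simp: ok_def)
      then have nba: "(b, a) \<notin> (D - {(b, a)})\<^sup>*" using strong_remove[OF D0(2)] by blast
      have "E\<^sup>* \<subseteq> (D - {(b, a)})\<^sup>*" by (rule rtrancl_mono) (auto simp: EE)
      then have "(b, a) \<notin> E\<^sup>*" using nba by blast
      moreover have "(a, b) \<in> E\<^sup>* \<or> (b, a) \<in> E\<^sup>*"
        unfolding EE
      proof (rule strong_edge_detour[OF D0(2) _ abD])
        show "D \<subseteq> V \<times> V" using DC CV by blast
        have "(a, b) \<in> C0" "(b, a) \<in> C0" using DC abD by auto
        then show "(a, b) \<in> (D \<union> D\<inverse> - {(a, b), (b, a)})\<^sup>*" unfolding DD by (rule nobridge)
      qed
      ultimately have "(a, b) \<in> E\<^sup>*" by blast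
      moreover have "E\<^sup>* \<subseteq> (D - {(a, b)})\<^sup>*" by (rule rtrancl_mono) (auto simp: EE)
      ultimately have "V \<times> V \<subseteq> (D - {(a, b)})\<^sup>*" using strong_remove[OF D0(2)] by blast
      then obtain P Q where d: "(P, Q) \<in> Dm" "\<not> sat Z (D - {(a, b)}) (P, Q)"
        using nok[OF abD(1)] o by (fastforce simp: ok_def)
      have "sat Z D (P, Q)" using D0 d by blast
      then obtain p q where pq: "p \<in> P" "q \<in> Q" "link Z D p q" unfolding sat_def by auto
      have e: "(p = a \<or> leaves Z E p a)" "(b = q \<or> enters Z E b q)"
        using ends[of P Q p q a b] pq d ab by auto
      have inZ: "p \<in> Z" "q \<in> Z" using dm[OF d(1)] pq by auto
      have "(b, q) \<in> E\<^sup>*" using e(2)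
        by (metis empty_subsetI enters_reach empty_iff reach_empty rtrancl.rtrancl_refl)
      moreover have "(q, p) \<in> (D - {(b, a)})\<^sup>*" using span[OF o(1) all] inZ by blast
      moreover have "(p, a) \<in> E\<^sup>*" using e(1)
        by (metis empty_subsetI reach_leaves empty_iff reach_empty rtrancl.rtrancl_refl)
      ultimately have "(b, a) \<in> (D - {(b, a)})\<^sup>*"
        using \<open>E\<^sup>* \<subseteq> (D - {(b, a)})\<^sup>*\<close> by (meson rtrancl_trans subsetD)
      then show False using nba by blast
    qed
    show False using no_both one_way[of x y] one_way[of y x] by blast
  qed
  then have "D \<inter> D\<inverse> = {}" by auto
  then show thesis using that D0 by blast
qed

section \<open>Splitting the neighbours of the centre\<close>

text \<open>
  Read \<open>L\<close> as the relation of being linked, and \<open>Nm\<close> as the set of vertices whose edge to the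
  centre \<open>u\<close> is directed towards \<open>u\<close>. The members of \<open>X\<close> are linked from \<open>u\<close> in any case; they are
  placed in \<open>Nm\<close>, which gives them a short route in both directions, and they may support others.

  \<open>Nm\<close> is chosen as large as possible such that each of its members outside \<open>X\<close> is supported by a
  link from \<open>u\<close>, from \<open>X\<close> or from outside \<open>Nm\<close>. It contains all vertices without outgoing link and
  none that is linked to \<open>u\<close>. If a vertex \<open>v\<close> cannot be added, then either it is the only support
  of some member of \<open>Nm\<close>, hence linked to it; these vertices form \<open>T\<close>. Or \<open>v\<close> lacks support itself,
  and then every vertex outside \<open>Nm\<close> to which \<open>v\<close> is linked has support, hence belongs to \<open>T\<close>
  or is linked to \<open>u\<close>. Thus at most two links lead from \<open>v\<close> to \<open>Nm\<close> or to a vertex linked to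
  \<open>u\<close>.
\<close>

lemma two_colouring:
  fixes L :: "'a \<Rightarrow> 'a \<Rightarrow> bool"
  assumes fin: "finite N" and uN: "u \<notin> N"
    and noniso: "\<And>v. v \<in> N \<Longrightarrow> \<exists>z\<in>insert u N. z \<noteq> v \<and> (L v z \<or> L z v)"
    and X: "X \<subseteq> N" "\<And>x. x \<in> X \<Longrightarrow> L u x \<and> \<not> L x u"
  obtains Nm T where "X \<subseteq> Nm" "Nm \<subseteq> N" "\<And>w. w \<in> Nm \<Longrightarrow> \<not> L w u"
    "T \<subseteq> N - Nm" "\<And>v. v \<in> T \<Longrightarrow> \<not> L v u \<and> (\<exists>w\<in>Nm - X. L v w)"
    "\<And>w. w \<in> Nm - X \<Longrightarrow> \<exists>p\<in>(N - Nm) \<union> X \<union> {u}. L p w"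
    "\<And>v. v \<in> N - Nm \<Longrightarrow> \<not> L v u \<Longrightarrow> v \<notin> T \<Longrightarrow>
       \<exists>q \<in> T \<union> Nm \<union> {q \<in> N. L q u}. L v q"
proof -
  define S where "S = {v \<in> N. \<forall>z\<in>insert u N. z \<noteq> v \<longrightarrow> \<not> L v z}"
  define ok where "ok I \<longleftrightarrow> X \<union> S \<subseteq> I \<and> I \<subseteq> {v \<in> N. \<not> L v u} \<and>
    (\<forall>w\<in>I - X. \<exists>p\<in>(N - I) \<union> X \<union> {u}. L p w)" for I
  have "ok (X \<union> S)"
    unfolding ok_def
  proof (intro conjI ballI)
    show "X \<union> S \<subseteq> {v \<in> N. \<not> L v u}" using X uN by (auto simp: S_def)
    fix w assume "w \<in> X \<union> S - X"
    then have w: "w \<in> S" "w \<notin> X" by auto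
    then obtain z where z: "z \<in> insert u N" "z \<noteq> w" "L z w"
      using noniso[of w] by (auto simp: S_def)
    have "z \<in> S \<Longrightarrow> False" using z w by (auto simp: S_def)
    then show "\<exists>p\<in>(N - (X \<union> S)) \<union> X \<union> {u}. L p w" using z by auto
  qed simp
  moreover have "\<forall>I. ok I \<longrightarrow> card I \<le> card N"
    using fin by (auto simp: ok_def intro!: card_mono)
  ultimately obtain I where I: "ok I" and maxI: "\<And>J. ok J \<Longrightarrow> card J \<le> card I"
    using ex_has_greatest_nat[of ok "X \<union> S" card "Suc (card N)"] by (auto simp: less_Suc_eq_le)
  have I1: "X \<subseteq> I" "S \<subseteq> I" "I \<subseteq> N" "\<And>w. w \<in> I \<Longrightarrow> \<not> L w u"
    "\<And>w. w \<in> I - X \<Longrightarrow> \<exists>p\<in>(N - I) \<union> X \<union> {u}. L p w"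
    using I by (auto simp: ok_def)
  define T where "T = {v \<in> N - I. \<not> L v u \<and> (\<exists>w\<in>I - X. L v w)}"
  (* Maximality of I, applied to the set with v added. *)
  have dich: "v \<in> T \<or> \<not> (\<exists>p\<in>(N - I - {v}) \<union> X \<union> {u}. L p v)"
    if v: "v \<in> N - I" "\<not> L v u" for v
  proof -
    have finI: "finite I" using I1 fin finite_subset by blast
    then have "\<not> ok (insert v I)" using maxI[of "insert v I"] v by auto
    then obtain w where w: "w \<in> insert v I - X" "\<not> (\<exists>p\<in>(N - insert v I) \<union> X \<union> {u}. L p w)"
      using v I1 unfolding ok_def by blast
    show ?thesis
    proof (cases "w = v")
      case True
      then show ?thesis using w(2) by auto
    next
      case False
      then have "w \<in> I - X" using w by auto
      then have "L v w" using I1(5)[of w] w(2) by auto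
      then show ?thesis using v \<open>w \<in> I - X\<close> by (auto simp: T_def)
    qed
  qed
  have out: "\<exists>q \<in> T \<union> I \<union> {q \<in> N. L q u}. L v q"
    if v: "v \<in> N - I" "\<not> L v u" "v \<notin> T" for v
  proof -
    have "v \<notin> S" using v I1 by auto
    then obtain q where q: "q \<in> insert u N" "q \<noteq> v" "L v q" using v by (auto simp: S_def)
    then have "q \<in> N" using v by auto
    show ?thesis
    proof (cases "q \<in> I \<or> L q u")
      case False
      then have "q \<in> T" using dich[of q] q v \<open>q \<in> N\<close> by auto
      then show ?thesis using q by auto
    qed (use q \<open>q \<in> N\<close> in auto)
  qed
  show thesis
    by (rule that[of I T]) (use I1 out in \<open>auto simp: T_def\<close>)
qed

section \<open>Mixed bipartite graphs with a centre\<close>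

text \<open>
  \<open>card (A - Av)\<close> bounds the number of vertices in \<open>A\<close> on a walk that avoids \<open>Av\<close>.
\<close>

definition bounded_orientation :: "'a set \<Rightarrow> 'a set \<Rightarrow> 'a rel \<Rightarrow> nat \<Rightarrow> bool" where
  "bounded_orientation V A M k \<longleftrightarrow> (\<exists>D. orients D M \<and> D \<inter> D\<inverse> = {} \<and>
     (\<forall>x\<in>V. \<forall>y\<in>V. \<exists>Av. reach Av D x y \<and> card (A - Av) \<le> k))"

text \<open>
  Allows to exchange the roles of in-neighbours and out-neighbours of the centre.
\<close>

lemma bounded_orientation_converse:
  assumes "bounded_orientation V A (M\<inverse>) k"
  shows "bounded_orientation V A M k"
proof -
  obtain D where D: "orients D (M\<inverse>)" "D \<inter> D\<inverse> = {}"
    "\<forall>x\<in>V. \<forall>y\<in>V. \<exists>Av. reach Av D x y \<and> card (A - Av) \<le> k"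
    using assms unfolding bounded_orientation_def by blast
  have "D \<subseteq> M\<inverse>" "D\<inverse> \<union> D = M \<union> M\<inverse>"
    using D(1) by (simp_all add: orients_def Un_commute)
  moreover from this(1) have "D\<inverse> \<subseteq> M" by auto
  ultimately have "orients (D\<inverse>) M" unfolding orients_def by simp
  moreover have "D\<inverse> \<inter> (D\<inverse>)\<inverse> = {}" using D(2) by blast
  moreover have "\<exists>Av. reach Av (D\<inverse>) x y \<and> card (A - Av) \<le> k" if "x \<in> V" "y \<in> V" for x y
    using D(3) that by (simp add: reach_converse)
  ultimately show ?thesis unfolding bounded_orientation_def by blast
qed

text \<open>
  \<open>M\<close> consists of the possible directions of the edges of a bridgeless mixed graph, \<open>A\<close> is one of
  its partite sets, and the centre \<open>u\<close> is a vertex of the other one.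
\<close>

locale mixed_star =
  fixes V A :: "'a set" and M :: "'a rel" and u :: 'a
  assumes finV: "finite V" and MV: "M \<subseteq> V \<times> V" and AV: "A \<subseteq> V"
    and bip: "(x, y) \<in> M \<Longrightarrow> x \<in> A \<longleftrightarrow> y \<notin> A"
    and strong: "V \<times> V \<subseteq> M\<^sup>*"
    and nobridge: "(x, y) \<in> M \<Longrightarrow> (y, x) \<in> M \<Longrightarrow>
      (x, y) \<in> ((M \<union> M\<inverse>) - {(x, y), (y, x)})\<^sup>*"
    and uV: "u \<in> V" and uA: "u \<notin> A"
begin

definition N :: "'a set" where "N = {v. (u, v) \<in> M \<and> (v, u) \<in> M}"
definition Out :: "'a set" where "Out = {v. (u, v) \<in> M \<and> (v, u) \<notin> M}"
definition In :: "'a set" where "In = {v. (v, u) \<in> M \<and> (u, v) \<notin> M}"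
definition Z :: "'a set" where "Z = insert u N"

text \<open>
  The undirected edges at \<open>u\<close> are directed, towards \<open>u\<close> from \<open>I\<close> and away from \<open>u\<close> otherwise. They
  are the only edges inside \<open>Z\<close>, since \<open>N\<close> lies in \<open>A\<close>. No link uses them, so links are the same
  before and after.
\<close>

definition star :: "'a set \<Rightarrow> 'a rel" where
  "star I = (M - Z \<times> Z) \<union> {u} \<times> (N - I) \<union> I \<times> {u}"

lemma converse: "mixed_star V A (M\<inverse>) u"
proof
  show "M\<inverse> \<subseteq> V \<times> V" using MV by auto
  show "V \<times> V \<subseteq> (M\<inverse>)\<^sup>*" using strong by (auto simp: rtrancl_converse)
  show "(x, y) \<in> (M\<inverse> \<union> (M\<inverse>)\<inverse> - {(x, y), (y, x)})\<^sup>*"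
    if "(x, y) \<in> M\<inverse>" "(y, x) \<in> M\<inverse>" for x y
    using nobridge[of x y] that by (simp add: Un_commute)
qed (use finV AV bip uV uA in auto)

lemma finA: "finite A" using AV finV finite_subset by blast

lemma nbrs_in_A: "N \<subseteq> A" "Out \<subseteq> A" "In \<subseteq> A"
  using bip uA by (auto simp: N_def Out_def In_def)

lemma finN: "finite N" using nbrs_in_A finA finite_subset by blast

lemma uN: "u \<notin> N" using nbrs_in_A uA by auto

lemma NZ: "N \<subseteq> Z" "u \<in> Z" by (auto simp: Z_def)

lemma nbrs_disjoint: "Out \<inter> Z = {}" "In \<inter> Z = {}"
  using nbrs_in_A uA by (auto simp: N_def Out_def In_def Z_def)

lemma arcs_in_Z: "(x, y) \<in> M \<Longrightarrow> x \<in> Z \<Longrightarrow> y \<in> Z \<Longrightarrow>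
    x = u \<and> y \<in> N \<or> x \<in> N \<and> y = u"
  using bip[of x y] nbrs_in_A uA by (auto simp: Z_def)

lemma Out_iff: "(u, s) \<in> M \<Longrightarrow> s \<notin> Z \<Longrightarrow> s \<in> Out"
  by (auto simp: Out_def Z_def N_def)

lemma star_sub: "I \<subseteq> N \<Longrightarrow> star I \<subseteq> M"
  by (auto simp: star_def N_def)

lemma orients_star: assumes "I \<subseteq> N" shows "orients (star I) M"
proof -
  have "(x, y) \<in> star I \<union> (star I)\<inverse>" if "(x, y) \<in> M" for x y
    using that arcs_in_Z[OF that] by (auto simp: star_def)
  then show ?thesis using star_sub[OF assms] by (auto simp: orients_def)
qed

lemma star_outside: "x \<notin> Z \<or> y \<notin> Z \<Longrightarrow> I \<subseteq> N \<Longrightarrow> (x, y) \<in> star I \<longleftrightarrow> (x, y) \<in> M"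
  by (auto simp: star_def Z_def)

lemma inner_star: "I \<subseteq> N \<Longrightarrow> inner Z (star I) = inner Z M"
  using star_outside by (auto simp: inner_def)

lemma enters_star: "I \<subseteq> N \<Longrightarrow> enters Z (star I) x q \<longleftrightarrow> enters Z M x q"
  unfolding enters_def
  by (metis (no_types, lifting) inner_star reach_def reach_target star_outside)

lemma leaves_star: "I \<subseteq> N \<Longrightarrow> leaves Z (star I) p y \<longleftrightarrow> leaves Z M p y"
  unfolding leaves_def
  by (metis (no_types, lifting) inner_star reach_def star_outside)

lemma link_star: assumes "I \<subseteq> N" shows "link Z (star I) p q \<longleftrightarrow> link Z M p q"
proof -
  have "(\<exists>a. (p, a) \<in> star I \<and> enters Z M a q) \<longleftrightarrow> (\<exists>a. (p, a) \<in> M \<and> enters Z M a q)"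
    by (metis assms enters_def reach_source star_outside)
  then show ?thesis unfolding link_def enters_star[OF assms] .
qed

lemma star_arcs:
  assumes "I \<subseteq> N" "orients D (star I)"
  shows "v \<in> N - I \<Longrightarrow> (u, v) \<in> D" "w \<in> I \<Longrightarrow> (w, u) \<in> D"
proof -
  have *: "(x, y) \<in> D" if "(x, y) \<in> star I" "(y, x) \<notin> star I" for x y
    using that assms(2) unfolding orients_def by blast
  show "v \<in> N - I \<Longrightarrow> (u, v) \<in> D" "w \<in> I \<Longrightarrow> (w, u) \<in> D"
    using assms(1) uN by (auto intro!: * simp: star_def Z_def)
qed

lemma star_no_sym: "I \<subseteq> N \<Longrightarrow> (x, y) \<in> star I \<Longrightarrow> (y, x) \<in> star I \<Longrightarrow> x \<notin> Z \<or> y \<notin> Z"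
  using uN by (auto simp: star_def Z_def)

lemma u_no_sym: "I \<subseteq> N \<Longrightarrow> (u, y) \<in> star I \<Longrightarrow> (y, u) \<notin> star I"
  using uN by (auto simp: star_def Z_def N_def)

lemma enters_Z: "x \<in> V \<Longrightarrow> x \<notin> Z \<Longrightarrow> V \<times> V \<subseteq> D\<^sup>* \<Longrightarrow> \<exists>h\<in>Z. enters Z D x h"
  using first_visit[of x u D Z] uV by (auto simp: Z_def)

lemma leaves_Z: "y \<in> V \<Longrightarrow> y \<notin> Z \<Longrightarrow> V \<times> V \<subseteq> D\<^sup>* \<Longrightarrow> \<exists>h\<in>Z. leaves Z D h y"
  using last_visit[of u y D Z] uV by (auto simp: Z_def)

lemma strong_via_Z:
  assumes "\<And>x. x \<in> V - Z \<Longrightarrow> \<exists>h\<in>Z. enters Z C x h"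
    and "\<And>y. y \<in> V - Z \<Longrightarrow> \<exists>h\<in>Z. leaves Z C h y" and "Z \<times> Z \<subseteq> C\<^sup>*"
  shows "V \<times> V \<subseteq> C\<^sup>*"
proof -
  have "\<exists>h\<in>Z. (x, h) \<in> C\<^sup>*" if "x \<in> V" for x
    using assms(1)[of x] that enters_reach[of Z C x _ "{}"] by (cases "x \<in> Z") (auto simp: reach_empty)
  moreover have "\<exists>h\<in>Z. (h, y) \<in> C\<^sup>*" if "y \<in> V" for y
    using assms(2)[of y] that reach_leaves[of Z C _ y "{}"] by (cases "y \<in> Z") (auto simp: reach_empty)
  ultimately show ?thesis using assms(3) by (auto, meson SigmaI rtrancl_trans subsetD)
qed

text \<open>
  The edge between \<open>u\<close> and \<open>v\<close> is not a bridge, so \<open>strong_edge_detour\<close> yields a walk between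
  its ends that does not use it. If this walk leads from \<open>v\<close> to \<open>u\<close>, the part from its last visit
  to \<open>v\<close> to the next vertex of \<open>Z\<close> is a link.
\<close>

lemma linked_neighbour:
  assumes v: "v \<in> N"
  shows "\<exists>z\<in>insert u N. z \<noteq> v \<and> (link Z M v z \<or> link Z M z v)"
proof -
  define M' where "M' = M - {(u, v), (v, u)}"
  define R where "R = inner {v} M'"
  have uv: "(u, v) \<in> M" "(v, u) \<in> M" "u \<noteq> v" "v \<in> A" using v uN nbrs_in_A by (auto simp: N_def)
  have RM: "R \<subseteq> M" by (auto simp: R_def inner_def M'_def)
  have aZ: "a \<notin> Z" if "(v, a) \<in> M' \<or> (a, v) \<in> M'" for a
    using that bip[of v a] bip[of a v] uv nbrs_in_A by (auto simp: Z_def M'_def)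
  have "(u, v) \<in> M'\<^sup>* \<or> (v, u) \<in> M'\<^sup>*"
    unfolding M'_def by (rule strong_edge_detour[OF strong MV]) (use uv nobridge in auto)
  then show ?thesis
  proof
    assume "(v, u) \<in> M'\<^sup>*"
    then obtain a where a: "(v, a) \<in> M'" "reach {v} M' a u"
      using last_visit[of v u M' "{v}"] uv by (auto simp: leaves_def)
    then have "(a, u) \<in> R\<^sup>*" by (simp add: reach_def R_def)
    then obtain h where h: "h \<in> Z" "enters Z R a h"
      using first_visit[of a u R Z] aZ a NZ by blast
    have "h \<noteq> v" using h(2) by (auto simp: enters_def R_def inner_def)
    moreover have "link Z M v h"
      using enters_mono[OF h(2) subset_refl RM] a(1) by (auto simp: link_def M'_def)
    ultimately show ?thesis using h by (auto simp: Z_def)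
  next
    assume "(u, v) \<in> M'\<^sup>*"
    then obtain b where b: "(b, v) \<in> M'" "reach {v} M' u b"
      using first_visit[of u v M' "{v}"] uv by (auto simp: enters_def)
    then have "(u, b) \<in> R\<^sup>*" by (simp add: reach_def R_def)
    then obtain h where h: "h \<in> Z" "leaves Z R h b"
      using last_visit[of u b R Z] aZ b NZ by blast
    have "h \<noteq> v" using h(2) by (auto simp: leaves_def R_def inner_def)
    moreover have "link Z M h v"
      using leaves_mono[OF h(2) subset_refl RM] b(1) by (auto simp: link_leaves M'_def)
    ultimately show ?thesis using h by (auto simp: Z_def)
  qed
qed

lemma card_A_bound:
  assumes "F \<subseteq> N"
  shows "card (A - (N - F)) \<le> card A - card N + card F"
    and "r \<in> A - N \<Longrightarrow> card (A - (N - F \<union> {r})) + 1 \<le> card A - card N + card F"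
proof -
  have fF: "finite F" using assms finN finite_subset by blast
  have e: "A - (N - F) = (A - N) \<union> F" using assms nbrs_in_A by auto
  have c: "card ((A - N) \<union> F) = card A - card N + card F"
    using assms finA fF nbrs_in_A finN by (subst card_Un_disjoint) (auto simp: card_Diff_subset)
  then show "card (A - (N - F)) \<le> card A - card N + card F" by (simp add: e)
  assume r: "r \<in> A - N"
  then have "A - (N - F \<union> {r}) \<subset> A - (N - F)" by auto
  then have "card (A - (N - F \<union> {r})) < card (A - (N - F))"
    using finA by (intro psubset_card_mono) auto
  then show "card (A - (N - F \<union> {r})) + 1 \<le> card A - card N + card F" using e c by simp
qed

lemma star_strong:
  assumes "I \<subseteq> N" "Z \<times> Z \<subseteq> (star I)\<^sup>*"
  shows "V \<times> V \<subseteq> (star I)\<^sup>*"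
  by (rule strong_via_Z)
    (use assms enters_Z[OF _ _ strong] leaves_Z[OF _ _ strong] in
      \<open>auto simp: enters_star leaves_star\<close>)

text \<open>
  Since all edges at \<open>u\<close> are directed already, a demand for a closed link is harmless at \<open>u\<close>, and
  the exchange of tails never happens at \<open>u\<close>.
\<close>

lemma star_orientation_with_links:
  assumes I: "I \<subseteq> N"
    and C0: "orients C0 (star I)" "V \<times> V \<subseteq> C0\<^sup>*"
    and dm: "\<And>P Q. (P, Q) \<in> Dm \<Longrightarrow> P \<subseteq> Z \<and> Q \<subseteq> Z \<and> P \<inter> Q \<subseteq> {u}"
    and sat0: "\<And>d. d \<in> Dm \<Longrightarrow> sat Z C0 d"
    and span: "\<And>C. orients C C0 \<Longrightarrow> \<forall>d\<in>Dm. sat Z C d \<Longrightarrow> Z \<times> Z \<subseteq> C\<^sup>*"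
    and uncross: "\<And>C P1 Q1 P2 Q2 p1 q1 p2 q2. C \<subseteq> M \<Longrightarrow> (P1, Q1) \<in> Dm \<Longrightarrow> (P2, Q2) \<in> Dm \<Longrightarrow>
      p1 \<in> P1 \<Longrightarrow> q1 \<in> Q1 \<Longrightarrow> p2 \<in> P2 \<Longrightarrow> q2 \<in> Q2 \<Longrightarrow>
      link Z C p1 q2 \<or> p1 = q2 \<and> p1 \<noteq> u \<Longrightarrow> link Z C p2 q1 \<or> p2 = q1 \<and> p2 \<noteq> u \<Longrightarrow>
      sat Z C (P1, Q1) \<or> sat Z C (P2, Q2)"
  obtains D where "orients D C0" "D \<inter> D\<inverse> = {}" "V \<times> V \<subseteq> D\<^sup>*" "\<forall>d\<in>Dm. sat Z D d"
proof -
  have sub: "C0 \<subseteq> star I" "C0 \<union> C0\<inverse> = M \<union> M\<inverse>" "C0 \<subseteq> M"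
    using orients_trans[OF C0(1) orients_star[OF I]] C0(1) by (auto simp: orients_def)
  have no_u: "(u, y) \<in> C0 \<Longrightarrow> (y, u) \<notin> C0" for y
    using u_no_sym[OF I] sub(1) by blast
  show thesis
  proof (rule orientation_with_links[of V C0 Z Dm])
    show "finite V" by (rule finV)
    show "C0 \<subseteq> V \<times> V" using sub MV by blast
    show "(x, x) \<notin> C0" for x using sub bip by blast
    show "V \<times> V \<subseteq> C0\<^sup>*" by (rule C0)
    show "(x, y) \<in> (C0 \<union> C0\<inverse> - {(x, y), (y, x)})\<^sup>*" if "(x, y) \<in> C0" "(y, x) \<in> C0" for x y
      unfolding sub(2) by (rule nobridge) (use that sub in auto)
    show "x \<notin> Z \<or> y \<notin> Z" if "(x, y) \<in> C0" "(y, x) \<in> C0" for x y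
      using star_no_sym[OF I] that sub(1) by blast
    show "P \<subseteq> Z \<and> Q \<subseteq> Z" if "(P, Q) \<in> Dm" for P Q using dm[OF that] by blast
    show "(y, p) \<notin> C0" if "(P, Q) \<in> Dm" "p \<in> P" "p \<in> Q" "(p, y) \<in> C0" for P Q p y
      using dm[OF that(1)] that no_u by blast
    show "sat Z C0 d" if "d \<in> Dm" for d using sat0 that .
    show "Z \<times> Z \<subseteq> C\<^sup>*" if "orients C C0" "\<forall>d\<in>Dm. sat Z C d" for C using span that .
    show "sat Z C (P1, Q1) \<or> sat Z C (P2, Q2)"
      if "C \<subseteq> C0" "(P1, Q1) \<in> Dm" "(P2, Q2) \<in> Dm" "p1 \<in> P1" "q1 \<in> Q1" "p2 \<in> P2" "q2 \<in> Q2"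
        "link Z C p1 q2 \<or> p1 = q2 \<and> (\<exists>y. (p1, y) \<in> C0 \<and> (y, p1) \<in> C0)"
        "link Z C p2 q1 \<or> p2 = q1 \<and> (\<exists>y. (p2, y) \<in> C0 \<and> (y, p2) \<in> C0)"
      for C P1 Q1 P2 Q2 p1 q1 p2 q2
      by (rule uncross[of C P1 Q1 P2 Q2 p1 q1 p2 q2]) (use that sub no_u in auto)
  qed (use that in blast)
qed

section \<open>Directing the edges at the centre of a mixed graph\<close>

definition U_in :: "'a set" where "U_in = {v \<in> N. link Z M v u}"

text \<open>
  The splitting of \<open>N\<close> by \<open>two_colouring\<close>, with the links that it promises realised in one strong
  orientation. What \<open>X\<close> has to be depends on whether there is a closed link at \<open>u\<close>, from an
  out-neighbour \<open>s\<close> of \<open>u\<close> to an in-neighbour of \<open>u\<close>. If there is one, it is demanded, and it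
  provides a free return to \<open>u\<close> from \<open>s\<close>; then \<open>X\<close> is empty. If there is none, the vertices that
  are linked from \<open>u\<close> but not to \<open>u\<close> form \<open>X\<close>, and they keep their link from \<open>u\<close>. Demanding both
  would be inconsistent: a link from \<open>u\<close> to \<open>X\<close> and one from \<open>U_in\<close> to \<open>u\<close> may need an edge in
  opposite directions, and an exchange of tails replaces them by a closed link at \<open>u\<close> and a link
  from \<open>U_in\<close> to \<open>X\<close>, which meet neither demand.

  The demands have six types. When the tails of two links are exchanged, the link from a source
  of one demand to a target of the other meets one of the two demands, or it would be a link to
  or from \<open>u\<close> that is known not to exist.
\<close>

lemma mixed_orientation:
  obtains D Nm T X where
    "orients D M" "D \<inter> D\<inverse> = {}" "V \<times> V \<subseteq> D\<^sup>*" "Nm \<subseteq> N"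
    "\<And>v. v \<in> N - Nm \<Longrightarrow> (u, v) \<in> D" "\<And>w. w \<in> Nm \<Longrightarrow> (w, u) \<in> D"
    "X = (if link Z M u u then {} else {v \<in> N. link Z M u v \<and> \<not> link Z M v u})"
    "X \<subseteq> Nm" "\<And>w. w \<in> Nm \<Longrightarrow> \<not> link Z M w u"
    "T \<subseteq> N - Nm" "\<And>v. v \<in> T \<Longrightarrow> \<not> link Z M v u \<and> (\<exists>w\<in>Nm - X. link Z D v w)"
    "\<And>w. w \<in> Nm - X \<Longrightarrow> \<exists>p\<in>(N - Nm) \<union> X \<union> {u}. link Z D p w"
    "\<And>v. v \<in> N - Nm \<Longrightarrow> \<not> link Z M v u \<Longrightarrow> v \<notin> T \<Longrightarrow> \<exists>q\<in>T \<union> Nm \<union> U_in. link Z D v q"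
    "\<And>v. v \<in> U_in \<Longrightarrow> link Z D v u"
    "\<And>w. w \<in> X \<Longrightarrow> link Z D u w"
    "link Z M u u \<Longrightarrow> link Z D u u"
proof -
  define X where "X = (if link Z M u u then {} else {v \<in> N. link Z M u v \<and> \<not> link Z M v u})"
  have X: "X \<subseteq> N" "\<And>x. x \<in> X \<Longrightarrow> link Z M u x \<and> \<not> link Z M x u" "\<And>x. x \<in> X \<Longrightarrow> \<not> link Z M u u"
    by (auto simp: X_def split: if_splits)
  obtain Nm T where NT: "X \<subseteq> Nm" "Nm \<subseteq> N" "\<And>w. w \<in> Nm \<Longrightarrow> \<not> link Z M w u"
    "T \<subseteq> N - Nm" "\<And>v. v \<in> T \<Longrightarrow> \<not> link Z M v u \<and> (\<exists>w\<in>Nm - X. link Z M v w)"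
    "\<And>w. w \<in> Nm - X \<Longrightarrow> \<exists>p\<in>(N - Nm) \<union> X \<union> {u}. link Z M p w"
    "\<And>v. v \<in> N - Nm \<Longrightarrow> \<not> link Z M v u \<Longrightarrow> v \<notin> T \<Longrightarrow>
       \<exists>q \<in> T \<union> Nm \<union> {q \<in> N. link Z M q u}. link Z M v q"
    by (rule two_colouring[of N u "link Z M" X, OF finN uN linked_neighbour X(1,2)]; (assumption | rule that; assumption))
  (* A member of Nm outside X is linked from u only in the case that X is empty by definition. *)
  have max: "link Z M u u" if "w \<in> Nm - X" "link Z M u w" for w
    using that NT(2,3) unfolding X_def by (auto split: if_splits)
  define Dm where "Dm = (\<lambda>v. ({v}, Nm - X)) ` T \<union>
    (\<lambda>v. ({v}, T \<union> Nm \<union> U_in)) ` (N - Nm - U_in - T) \<union>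
    (\<lambda>v. ({v}, {u})) ` U_in \<union>
    (\<lambda>w. ((N - Nm) \<union> X \<union> {u}, {w})) ` (Nm - X) \<union>
    (\<lambda>w. ({u}, {w})) ` X \<union>
    (if link Z M u u then {({u}, {u})} else {})"
  have Uin: "U_in \<subseteq> N - Nm" "\<And>v. v \<in> N \<Longrightarrow> link Z M v u \<Longrightarrow> v \<in> U_in" "\<And>v. v \<in> U_in \<Longrightarrow> link Z M v u"
    using NT by (auto simp: U_in_def)
  note subs = NT(1,2,4) Uin(1) X(1) uN
  have sat_iff: "(\<forall>d\<in>Dm. sat Z C d) \<longleftrightarrow>
      (\<forall>v\<in>T. \<exists>w\<in>Nm - X. link Z C v w) \<and>
      (\<forall>v\<in>N - Nm - U_in - T. \<exists>q\<in>T \<union> Nm \<union> U_in. link Z C v q) \<and>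
      (\<forall>v\<in>U_in. link Z C v u) \<and>
      (\<forall>w\<in>Nm - X. \<exists>p\<in>(N - Nm) \<union> X \<union> {u}. link Z C p w) \<and>
      (\<forall>w\<in>X. link Z C u w) \<and> (link Z M u u \<longrightarrow> link Z C u u)" for C
    unfolding Dm_def sat_def by (simp add: ball_Un)
  have span: "Z \<times> Z \<subseteq> C\<^sup>*" if C: "orients C (star Nm)" "\<forall>d\<in>Dm. sat Z C d" for C
  proof -
    have to_u: "\<And>w. w \<in> Nm \<Longrightarrow> (w, u) \<in> C\<^sup>*" and from_u: "\<And>v. v \<in> N - Nm \<Longrightarrow> (u, v) \<in> C\<^sup>*"
      using star_arcs[OF NT(2) C(1)] by auto
    note s = C(2)[unfolded sat_iff]
    have 1: "v \<in> U_in \<Longrightarrow> (v, u) \<in> C\<^sup>*" for v using s link_rtrancl by metis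
    have 2: "v \<in> T \<Longrightarrow> (v, u) \<in> C\<^sup>*" for v using s link_rtrancl to_u rtrancl_trans by (metis DiffD1)
    have 3: "(v, u) \<in> C\<^sup>*" if "v \<in> N" for v
      using s 1 2 to_u link_rtrancl rtrancl_trans that by (metis Diff_iff Un_iff)
    have 4: "w \<in> X \<Longrightarrow> (u, w) \<in> C\<^sup>*" for w using s link_rtrancl by metis
    have 5: "(u, w) \<in> C\<^sup>*" if "w \<in> N" for w
    proof (cases "w \<in> Nm - X")
      case True
      then obtain p where p: "p \<in> (N - Nm) \<union> X \<union> {u}" "link Z C p w" using s by blast
      then have "(u, p) \<in> C\<^sup>*" using from_u 4 by blast
      then show ?thesis using link_rtrancl[OF p(2)] by (rule rtrancl_trans)
    qed (use that from_u 4 in blast)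
    show ?thesis using 3 5 unfolding Z_def
      by (auto intro: rtrancl_trans)
  qed
  have sat0: "\<forall>d\<in>Dm. sat Z (star Nm) d"
    unfolding sat_iff link_star[OF NT(2)]
  proof (intro conjI ballI impI)
    fix v assume "v \<in> N - Nm - U_in - T"
    then show "\<exists>q\<in>T \<union> Nm \<union> U_in. link Z M v q"
      using NT(7)[of v] Uin(2)[of v] by (simp add: U_in_def)
  next
    fix w assume "w \<in> Nm - X"
    then show "\<exists>p\<in>(N - Nm) \<union> X \<union> {u}. link Z M p w" by (rule NT(6))
  qed (simp_all add: NT(5) X Uin(3))
  have str: "V \<times> V \<subseteq> (star Nm)\<^sup>*"
    by (rule star_strong[OF NT(2)]) (rule span, use sat0 in \<open>auto simp: orients_def\<close>)
  obtain D where D: "orients D (star Nm)" "D \<inter> D\<inverse> = {}" "V \<times> V \<subseteq> D\<^sup>*" "\<forall>d\<in>Dm. sat Z D d"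
  proof (rule star_orientation_with_links[of Nm "star Nm" Dm])
    show "Nm \<subseteq> N" by (rule NT)
    show "orients (star Nm) (star Nm)" by (simp add: orients_def)
    show "V \<times> V \<subseteq> (star Nm)\<^sup>*" by (rule str)
    show "P \<subseteq> Z \<and> Q \<subseteq> Z \<and> P \<inter> Q \<subseteq> {u}" if "(P, Q) \<in> Dm" for P Q
      using that subs unfolding Dm_def Z_def by (auto split: if_splits)
    show "sat Z (star Nm) d" if "d \<in> Dm" for d using sat0 that by blast
    show "Z \<times> Z \<subseteq> C\<^sup>*" if "orients C (star Nm)" "\<forall>d\<in>Dm. sat Z C d" for C by (rule span[OF that])
    show "sat Z C (P1, Q1) \<or> sat Z C (P2, Q2)"
      if CM: "C \<subseteq> M" and mem: "(P1, Q1) \<in> Dm" "(P2, Q2) \<in> Dm"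
        and pq: "p1 \<in> P1" "q1 \<in> Q1" "p2 \<in> P2" "q2 \<in> Q2"
        and l: "link Z C p1 q2 \<or> p1 = q2 \<and> p1 \<noteq> u" "link Z C p2 q1 \<or> p2 = q1 \<and> p2 \<noteq> u"
      for C P1 Q1 P2 Q2 p1 q1 p2 q2
    proof -
      have up: "link Z C p q \<Longrightarrow> link Z M p q" for p q using link_mono[OF _ subset_refl CM] .
      (* The six types of demands, in the order of their introduction. *)
      define ta where "ta P Q p q \<longleftrightarrow> p \<in> T \<and> P = {p} \<and> Q = Nm - X \<and> q \<in> Nm - X" for P Q p q
      define tb where "tb P Q p q \<longleftrightarrow> p \<in> N - Nm - U_in - T \<and> P = {p} \<and>
        Q = T \<union> Nm \<union> U_in \<and> q \<in> T \<union> Nm \<union> U_in" for P Q p q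
      define tc where "tc P Q p q \<longleftrightarrow> p \<in> U_in \<and> P = {p} \<and> Q = {u} \<and> q = u" for P Q p q
      define td where "td P Q p q \<longleftrightarrow> q \<in> Nm - X \<and> P = (N - Nm) \<union> X \<union> {u} \<and>
        p \<in> (N - Nm) \<union> X \<union> {u} \<and> Q = {q}" for P Q p q
      define te where "te P Q p q \<longleftrightarrow> q \<in> X \<and> P = {u} \<and> p = u \<and> Q = {q}" for P Q p q
      define tf where "tf P Q p q \<longleftrightarrow> P = {u} \<and> p = u \<and> Q = {u} \<and> q = u" for P Q p q
      note tdefs = ta_def tb_def tc_def td_def te_def tf_def
      have cases: "ta P Q p q \<or> tb P Q p q \<or> tc P Q p q \<or> td P Q p q \<or> te P Q p q \<or> tf P Q p q"
        if "(P, Q) \<in> Dm" "p \<in> P" "q \<in> Q" for P Q p q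
        using that unfolding Dm_def tdefs by (elim UnE imageE; simp split: if_splits)
      have pP: "p \<in> (N - Nm) \<union> X \<union> {u} \<and> p \<in> P \<and> q \<in> Q \<and> q \<in> T \<union> Nm \<union> U_in \<union> {u}"
        if "(P, Q) \<in> Dm" "p \<in> P" "q \<in> Q" for P Q p q
        using cases[OF that] subs unfolding tdefs by (elim disjE; blast)
      have nu: "\<forall>v. v \<in> T \<or> v \<in> N - Nm - U_in - T \<longrightarrow> \<not> link Z C v u"
        by (meson up Uin(2) NT(4,5) DiffD1 DiffD2 subsetD)
      have nu': "X \<noteq> {} \<longrightarrow> \<not> link Z C u u \<and> (\<forall>w\<in>Nm - X. \<not> link Z C u w)"
        by (meson X(3) up max all_not_in_conv)
      have satI: "link Z C p q \<Longrightarrow> p \<in> P \<Longrightarrow> q \<in> Q \<Longrightarrow> sat Z C (P, Q)" for p q P Q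
        by (auto simp: sat_def)
      (* The list of cases covers every pair of types in one of the two orders. *)
      have half: "sat Z C (P1, Q1) \<or> sat Z C (P2, Q2)"
        if mem: "(P1, Q1) \<in> Dm" "(P2, Q2) \<in> Dm"
          and pq: "p1 \<in> P1" "q1 \<in> Q1" "p2 \<in> P2" "q2 \<in> Q2"
          and l: "link Z C p1 q2 \<or> p1 = q2 \<and> p1 \<noteq> u" "link Z C p2 q1 \<or> p2 = q1 \<and> p2 \<noteq> u"
          and t: "td P2 Q2 p2 q2 \<or> tb P1 Q1 p1 q1 \<or>
            ta P1 Q1 p1 q1 \<and> \<not> tb P2 Q2 p2 q2 \<and> \<not> td P2 Q2 p2 q2 \<or>
            (tc P1 Q1 p1 q1 \<or> tf P1 Q1 p1 q1) \<and> (tc P2 Q2 p2 q2 \<or> tf P2 Q2 p2 q2) \<or>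
            te P1 Q1 p1 q1 \<and> (tc P2 Q2 p2 q2 \<or> te P2 Q2 p2 q2 \<or> tf P2 Q2 p2 q2)"
        for P1 Q1 p1 q1 P2 Q2 p2 q2
      proof -
        note p1 = pP[OF mem(1) pq(1,2)] and p2 = pP[OF mem(2) pq(3,4)]
        from t consider "td P2 Q2 p2 q2" | "tb P1 Q1 p1 q1"
          | "ta P1 Q1 p1 q1" "\<not> tb P2 Q2 p2 q2" "\<not> td P2 Q2 p2 q2"
          | "tc P1 Q1 p1 q1 \<or> tf P1 Q1 p1 q1" "tc P2 Q2 p2 q2 \<or> tf P2 Q2 p2 q2"
          | "te P1 Q1 p1 q1" "tc P2 Q2 p2 q2 \<or> te P2 Q2 p2 q2 \<or> tf P2 Q2 p2 q2" by blast
        then show ?thesis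
        proof cases
          case 1
          then have "p1 \<noteq> q2" "p1 \<in> P2" using p1 subs by (auto simp: td_def)
          then show ?thesis using l(1) satI[of p1 q2 P2 Q2] pq by blast
        next
          case 2
          then have "q2 \<noteq> u" "p1 \<noteq> q2 \<or> q2 = u" using nu p2 l(1) subs unfolding tb_def by blast+
          then have "q2 \<in> Q1" using 2 p2 by (auto simp: tb_def)
          then show ?thesis using l(1) 2 satI[of p1 q2 P1 Q1] pq subs unfolding tb_def by blast
        next
          case 3
          then have "ta P2 Q2 p2 q2 \<or> te P2 Q2 p2 q2 \<or> q2 = u"
            using cases[OF mem(2) pq(3,4)] by (auto simp: tc_def tf_def)
          moreover have "q2 \<noteq> u" using 3 l(1) nu subs unfolding ta_def by blast
          moreover have False if "te P2 Q2 p2 q2" using that 3 l(2) nu' subs unfolding ta_def te_def by blast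
          moreover have "sat Z C (P1, Q1)" if "ta P2 Q2 p2 q2"
          proof -
            have "p1 \<noteq> q2" "q2 \<in> Q1" using that 3 subs unfolding ta_def by blast+
            then show ?thesis using l(1) satI pq by blast
          qed
          ultimately show ?thesis by blast
        next
          case 4
          then have "q2 = u" "q2 \<in> Q1" by (auto simp: tc_def tf_def)
          then show ?thesis using l(1) satI[of p1 q2 P1 Q1] pq by blast
        next
          case 5
          then have "p1 = u" "q1 \<in> X" "q1 \<noteq> u" using subs by (auto simp: te_def)
          then show ?thesis
            using 5(2) l satI[of p2 q1 P1 Q1] nu' pq 5(1) subs
            by (auto simp: te_def tc_def tf_def)
        qed
      qed
      show ?thesis
        using half[OF mem pq l] half[OF mem(2,1) pq(3,4,1,2) l(2,1)]
          cases[OF mem(1) pq(1,2)] cases[OF mem(2) pq(3,4)] by satx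
    qed
  qed blast
  show thesis
  proof (rule that[of D Nm X T])
    note s = D(4)[unfolded sat_iff]
    show "orients D M" using orients_trans[OF D(1) orients_star[OF NT(2)]] .
    show "\<exists>q\<in>T \<union> Nm \<union> U_in. link Z D v q" if "v \<in> N - Nm" "\<not> link Z M v u" "v \<notin> T" for v
      using s that Uin by blast
    show "\<not> link Z M v u \<and> (\<exists>w\<in>Nm - X. link Z D v w)" if "v \<in> T" for v using s that NT(5) by blast
    show "\<exists>p\<in>(N - Nm) \<union> X \<union> {u}. link Z D p w" if "w \<in> Nm - X" for w using s that by blast
  qed (use D NT X_def star_arcs[OF NT(2) D(1)] D(4)[unfolded sat_iff] in auto)
qed

section \<open>Routes through the centre\<close>

lemma Z_avoid: "F \<subseteq> N \<Longrightarrow> N - F \<subseteq> Z" "u \<notin> N - F" "F \<subseteq> N \<Longrightarrow> N - F \<union> R \<subseteq> Z \<union> R"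
  using uN by (auto simp: Z_def)

lemma reach_union:
  assumes "reach (N - F \<union> R) D x y" "reach (N - F' \<union> R') D y z"
  shows "reach (N - (F \<union> F') \<union> (R \<inter> R')) D x z"
proof -
  have "reach (N - (F \<union> F') \<union> (R \<inter> R')) D x y" "reach (N - (F \<union> F') \<union> (R \<inter> R')) D y z"
    by (rule reach_mono[OF assms(1) _ subset_refl], blast,
        rule reach_mono[OF assms(2) _ subset_refl], blast)
  then show ?thesis by (rule reach_trans)
qed

text \<open>
  From \<open>x\<close> to \<open>u\<close>: go to the first vertex \<open>h\<close> of \<open>N\<close>, and then along at most two links to \<open>u\<close> or
  to \<open>Nm\<close>. Three vertices of \<open>N\<close> are needed only if \<open>h\<close> is linked to some \<open>q\<close> in \<open>T\<close> and \<open>q\<close> to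
  some \<open>w\<close> in \<open>Nm - X\<close>. From \<open>u\<close> to \<open>y\<close>: the last vertex of \<open>N\<close> is preceded by at most one other.

  When three and two vertices are needed, the routes can be kept away from a vertex adjacent to
  \<open>u\<close> by a directed edge. On the way to \<open>u\<close>, an in-neighbour of \<open>u\<close> would allow a shorter route, and
  an out-neighbour \<open>s\<close> would either be the start of the closed link at \<open>u\<close>, hence allow a shorter
  route, or it would make one of \<open>h\<close>, \<open>q\<close>, \<open>w\<close> a vertex linked from \<open>u\<close>, hence a member of \<open>X\<close>,
  to which none of them belongs.
  On the way from \<open>u\<close>, one may start with the last out-neighbour on the route, and no second one is
  needed; in-neighbours would again yield links to \<open>u\<close> that do not exist. If there are an
  out-neighbour and in addition another out-neighbour or an in-neighbour, one of them is
  missed by both routes. Without out-neighbours one passes to the reversed graph.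
\<close>

lemma mixed_routes:
  "\<exists>D. orients D M \<and> D \<inter> D\<inverse> = {} \<and> (\<forall>x\<in>V. \<forall>y\<in>V.
     \<exists>F\<subseteq>N. card F \<le> 5 \<and> reach (N - F) D x y \<and>
       (Out \<noteq> {} \<and> 2 \<le> card Out + card In \<longrightarrow>
         card F \<le> 4 \<or> (\<exists>r\<in>Out \<union> In. reach (N - F \<union> {r}) D x y)))"
proof -
  obtain D Nm T X where D:
    "orients D M" "D \<inter> D\<inverse> = {}" "V \<times> V \<subseteq> D\<^sup>*" "Nm \<subseteq> N"
    and star: "\<And>v. v \<in> N - Nm \<Longrightarrow> (u, v) \<in> D" "\<And>w. w \<in> Nm \<Longrightarrow> (w, u) \<in> D"
    and X: "X = (if link Z M u u then {} else {v \<in> N. link Z M u v \<and> \<not> link Z M v u})"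
    "X \<subseteq> Nm" and Nm: "\<And>w. w \<in> Nm \<Longrightarrow> \<not> link Z M w u"
    and T: "T \<subseteq> N - Nm" "\<And>v. v \<in> T \<Longrightarrow> \<not> link Z M v u \<and> (\<exists>w\<in>Nm - X. link Z D v w)"
    and into: "\<And>w. w \<in> Nm - X \<Longrightarrow> \<exists>p\<in>(N - Nm) \<union> X \<union> {u}. link Z D p w"
    and out: "\<And>v. v \<in> N - Nm \<Longrightarrow> \<not> link Z M v u \<Longrightarrow> v \<notin> T \<Longrightarrow> \<exists>q\<in>T \<union> Nm \<union> U_in. link Z D v q"
    and Uin: "\<And>v. v \<in> U_in \<Longrightarrow> link Z D v u"
    and Xl: "\<And>w. w \<in> X \<Longrightarrow> link Z D u w"
    and loop: "link Z M u u \<Longrightarrow> link Z D u u"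
    by (rule mixed_orientation; (assumption | rule that; assumption))
  have DM: "D \<subseteq> M" "D \<union> D\<inverse> = M \<union> M\<inverse>" using D(1) by (auto simp: orients_def)
  have kept: "(u, s) \<in> D" if "s \<in> Out" for s using that DM unfolding Out_def by blast
  have kept': "(s, u) \<in> D" if "s \<in> In" for s using that DM unfolding In_def by blast
  have up: "link Z D p q \<Longrightarrow> link Z M p q" "enters Z D p q \<Longrightarrow> enters Z M p q"
    "leaves Z D p q \<Longrightarrow> leaves Z M p q" for p q
    using link_mono enters_mono leaves_mono DM(1) by (metis subset_refl)+
  have Xu: "X \<noteq> {} \<Longrightarrow> \<not> link Z M u u" "\<And>w. w \<in> X \<Longrightarrow> link Z M u w \<and> \<not> link Z M w u"
    "\<And>w. w \<in> Nm \<Longrightarrow> \<not> link Z M u u \<Longrightarrow> link Z M u w \<Longrightarrow> w \<in> X"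
    using X(1) Nm D(4) by (auto split: if_splits)
  have XN: "X \<subseteq> N" "T \<subseteq> N" using X D T by auto

  (* R collects vertices to be missed. The condition on t covers in-neighbours of u, the first
     vertex of the closed link at u and, if there is no closed link, out-neighbours of u. *)
  have to_u: "(\<exists>F\<subseteq>N. card F \<le> 2 \<and> reach (N - F) D x u) \<or>
      (\<exists>F\<subseteq>N. card F \<le> 3 \<and> reach (N - F \<union> R) D x u)"
    if x: "x \<in> V" and R: "R \<inter> Z = {}"
      "\<And>t. t \<in> R \<Longrightarrow> enters Z D t u \<or> (u, t) \<in> M \<and> \<not> link Z M u u" for x R
  proof (cases "x = u")
    case True
    then show ?thesis using uN by (auto intro!: exI[of _ "{}"] reach_refl)
  next
    case False
    have "\<exists>h\<in>Z. x = h \<or> x \<notin> Z \<and> enters Z D x h"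
      using enters_Z[OF x _ D(3)] by blast
    then obtain h where h: "h \<in> Z" "x = h \<or> x \<notin> Z \<and> enters Z D x h" by blast
    show ?thesis
    proof (cases "enters Z D x u \<and> x \<notin> Z")
      case True
      then have "reach (N - {}) D x u" using enters_reach[of Z D x u N] NZ uN by auto
      then show ?thesis by (intro disjI1 exI[of _ "{}"]) auto
    next
      case no_u: False
      then have hN: "h \<in> N" using h False by (auto simp: Z_def)
      have xh: "reach (N - F) D x h" if "h \<in> F" "F \<subseteq> N" for F
        using h(2) enters_reach[OF _ Z_avoid(1)[OF that(2)], of D x h] that reach_refl[of h "N - F" D] by blast
      have short: ?thesis if F: "F \<subseteq> N" "h \<in> F" "card F \<le> 2" "reach (N - F) D h u" for F
        using F reach_trans[OF xh[OF F(2,1)] F(4)] by blast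
      have lk: "reach (N - F) D p q" if "link Z D p q" "F \<subseteq> N" "p \<in> insert u F" "q \<in> insert u F" for F p q
        using that uN by (intro link_reach[OF that(1) Z_avoid(1)]) auto
      have st: "reach (N - F) D w u" if "w \<in> Nm" "w \<in> F" for F w
        using that star(2) uN by (intro reach_step) auto
      show ?thesis
      proof (cases "h \<in> Nm \<or> link Z M h u")
        case True
        then have "reach (N - {h}) D h u"
          using st[of h "{h}"] lk[of h u "{h}"] Uin[of h] hN by (auto simp: U_in_def)
        then show ?thesis using short[of "{h}"] hN by simp
      next
        case not1: False
        have short2: ?thesis if q: "link Z D h q" "q \<in> Nm \<union> U_in" for q
        proof -
          have qN: "q \<in> N" using q D(4) by (auto simp: U_in_def)
          have "reach (N - {h, q}) D h q" using lk[of h q "{h, q}"] q hN qN by simp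
          moreover have "reach (N - {h, q}) D q u"
            using st[of q "{h, q}"] lk[of q u "{h, q}"] Uin[of q] q hN qN by auto
          ultimately have "reach (N - {h, q}) D h u" by (rule reach_trans)
          then show ?thesis using short[of "{h, q}"] hN qN by (simp add: card_insert_if)
        qed
        show ?thesis
        proof (cases "\<exists>q\<in>Nm \<union> U_in. link Z D h q")
          case True
          then show ?thesis using short2 by blast
        next
          case not2: False
          then have "h \<notin> T" using T(2)[of h] by blast
          then obtain q where q: "q \<in> T" "link Z D h q" using out[of h] hN not1 not2 by blast
          then obtain w where w: "w \<in> Nm - X" "link Z D q w" using T(2) by blast
          have qN: "q \<in> N" "w \<in> N" "q \<notin> Nm" "\<not> link Z M q u" using q w XN T D(4) by auto
          (* If an out-neighbour t of u were on the route in front of z, then z would be linked from u. *)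
          have bad: "\<not> (u, t) \<in> M" if "t \<in> R" "enters Z D t z" "\<not> enters Z D t u"
            "z \<in> N" "z \<notin> X" "\<not> link Z M z u" for t z
          proof
            assume "(u, t) \<in> M"
            then have "link Z M u z" using up(2)[OF that(2)] by (auto simp: link_def)
            moreover have "\<not> link Z M u u" using R(2) that by blast
            ultimately show False using X(1) that by auto
          qed
          let ?F = "{h, q, w}"
          have F: "?F \<subseteq> N" "card ?F \<le> 3" using hN qN by (auto simp: card_insert_if)
          have Rdis: "p \<notin> N - ?F \<union> R" if "p \<in> insert u ?F" for p
            using that F uN R(1) NZ by auto
          have 1: "reach (N - ?F \<union> R) D x h"
          proof (cases "x = h")
            case False
            then have e: "enters Z D x h" "x \<notin> Z" using h(2) by auto
            have "\<not> (\<exists>t\<in>R - Z. reach Z D x t \<and> enters Z D t h)"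
            proof
              assume "\<exists>t\<in>R - Z. reach Z D x t \<and> enters Z D t h"
              then obtain t where t: "t \<in> R" "reach Z D x t" "enters Z D t h" by blast
              have "\<not> enters Z D t u" using reach_enters[OF t(2)] no_u e by blast
              moreover have "h \<notin> X" using not1 X(2) by auto
              ultimately have "\<not> (u, t) \<in> M" using bad[OF t(1,3)] hN not1 by blast
              then show False using R(2)[OF t(1)] \<open>\<not> enters Z D t u\<close> by blast
            qed
            then have "enters (Z \<union> R) D x h" using enters_avoid[OF e(1), of R] by blast
            then show ?thesis by (rule enters_reach[OF _ Z_avoid(3)[OF F(1)]]) (rule Rdis, simp)
          qed (use Rdis in \<open>auto intro: reach_refl\<close>)
          have lka: "reach (N - ?F \<union> R) D p z"
            if l: "link Z D p z" "p \<in> ?F" "z \<in> ?F" "\<not> link Z M p u" "\<not> link Z M z u"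
              "z \<notin> X" for p z
          proof -
            have "\<not> (\<exists>t\<in>R - Z. leaves Z D p t \<and> enters Z D t z)"
            proof
              assume "\<exists>t\<in>R - Z. leaves Z D p t \<and> enters Z D t z"
              then obtain t where t: "t \<in> R" "leaves Z D p t" "enters Z D t z" by blast
              have "\<not> enters Z D t u" using leaves_enters[OF t(2)] l up(1) by blast
              then show False using bad[OF t(1,3)] R(2)[OF t(1)] l F(1) by blast
            qed
            then have "link (Z \<union> R) D p z" using link_avoid[OF l(1), of R] by blast
            then show ?thesis
              by (rule link_reach[OF _ Z_avoid(3)[OF F(1)]]) (use Rdis l in auto)
          qed
          have 2: "reach (N - ?F \<union> R) D h q"
            using lka[of h q] q not1 qN X(2) by auto
          have 3: "reach (N - ?F \<union> R) D q w"
            using lka[of q w] w qN Nm by auto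
          have 4: "reach (N - ?F \<union> R) D w u"
            by (rule reach_step) (use star(2) w Rdis in auto)
          have "reach (N - ?F \<union> R) D x u" using 1 2 3 4 reach_trans by metis
          then show ?thesis using F by blast
        qed
      qed
    qed
  qed

  (* R0 collects out-neighbours of u. The second form of R is used if the route starts with a
     link from u to X; it passes through the out-neighbour s and through no other. *)
  have from_u: "(\<exists>F\<subseteq>N. card F \<le> 1 \<and> reach (N - F) D u y) \<or>
      (\<exists>F\<subseteq>N. card F \<le> 2 \<and> (\<exists>R. reach (N - F \<union> R) D u y \<and>
        (R = R0 \<or> \<not> link Z M u u \<and> (\<exists>s\<in>Out. R = (Out - {s}) \<union> In))))"
    if y: "y \<in> V" and R0: "R0 \<inter> Z = {}" "\<And>t. t \<in> R0 \<Longrightarrow> (u, t) \<in> D" for y R0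
  proof (cases "y = u")
    case True
    then show ?thesis using uN by (auto intro!: exI[of _ "{}"] reach_refl)
  next
    case False
    have "\<exists>h\<in>Z. y = h \<or> y \<notin> Z \<and> leaves Z D h y"
      using leaves_Z[OF y _ D(3)] by blast
    then obtain h where h: "h \<in> Z" "y = h \<or> y \<notin> Z \<and> leaves Z D h y" by blast
    show ?thesis
    proof (cases "leaves Z D u y \<and> y \<notin> Z")
      case True
      then have "reach (N - {}) D u y" using reach_leaves[of Z D u y N] NZ uN by auto
      then show ?thesis by (intro disjI1 exI[of _ "{}"]) auto
    next
      case no_u: False
      then have hN: "h \<in> N" using h False by (auto simp: Z_def)
      have hy: "reach (N - F) D h y" if "h \<in> F" "F \<subseteq> N" for F
        using h(2) reach_leaves[OF _ Z_avoid(1)[OF that(2)], of D h y] that reach_refl[of h "N - F" D] by blast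
      have short: ?thesis if F: "reach (N - {h}) D u h"
        using reach_trans[OF F hy[of "{h}"]] hN by (intro disjI1 exI[of _ "{h}"]) simp
      have lk: "reach (N - F) D p q" if "link Z D p q" "F \<subseteq> N" "p \<in> insert u F" "q \<in> insert u F" for F p q
        using that uN by (intro link_reach[OF that(1) Z_avoid(1)]) auto
      show ?thesis
      proof (cases "h \<notin> Nm \<or> link Z D u h")
        case True
        then have "reach (N - {h}) D u h"
          using lk[of u h "{h}"] star(1)[of h] hN uN reach_step[of u h D "N - {h}"] by auto
        then show ?thesis by (rule short)
      next
        case not1: False
        then have "h \<in> Nm - X" using Xl by blast
        then obtain p where p: "p \<in> (N - Nm) \<union> X" "link Z D p h" using into not1 by blast
        have pN: "p \<in> N" using p XN by auto
        let ?F = "{p, h}"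
        have F: "?F \<subseteq> N" "card ?F \<le> 2" using hN pN by (auto simp: card_insert_if)
        (* The route from p on. An out-neighbour of u on it would be a better start, an in-neighbour
           would give a link to u from p or from h. *)
        have tail: "reach (N - ?F \<union> R) D p y"
          if R: "R \<inter> Z = {}" "\<And>t. t \<in> R \<Longrightarrow> (u, t) \<in> D \<or> (t, u) \<in> D \<and> p \<in> X" for R
        proof -
          have Rdis: "z \<notin> N - ?F \<union> R" if "z \<in> insert u ?F" for z
            using that F uN R(1) NZ by auto
          have "\<not> (\<exists>t\<in>R - Z. leaves Z D p t \<and> enters Z D t h)"
          proof
            assume "\<exists>t\<in>R - Z. leaves Z D p t \<and> enters Z D t h"
            then obtain t where t: "t \<in> R" "leaves Z D p t" "enters Z D t h" by blast
            from R(2)[OF t(1)] show False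
            proof
              assume "(u, t) \<in> D"
              then have "link Z D u h" using t by (auto simp: link_def)
              then show False using not1 by blast
            next
              assume "(t, u) \<in> D \<and> p \<in> X"
              then have "link Z D p u" "p \<in> X" using t by (auto simp: link_leaves)
              then show False using up(1) Xu(2) by blast
            qed
          qed
          then have "link (Z \<union> R) D p h" using link_avoid[OF p(2), of R] by blast
          then have 1: "reach (N - ?F \<union> R) D p h"
            by (rule link_reach[OF _ Z_avoid(3)[OF F(1)]]) (use Rdis in auto)
          have 2: "reach (N - ?F \<union> R) D h y"
          proof (cases "y = h")
            case False
            then have e: "leaves Z D h y" "y \<notin> Z" using h(2) by auto
            have "\<not> (\<exists>t\<in>R - Z. leaves Z D h t \<and> reach Z D t y)"
            proof
              assume "\<exists>t\<in>R - Z. leaves Z D h t \<and> reach Z D t y"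
              then obtain t where t: "t \<in> R" "leaves Z D h t" "reach Z D t y" by blast
              from R(2)[OF t(1)] show False
              proof
                assume "(u, t) \<in> D"
                then have "leaves Z D u y" using t by (auto simp: leaves_def)
                then show False using no_u e by blast
              next
                assume "(t, u) \<in> D \<and> p \<in> X"
                then have "link Z D h u" using t by (auto simp: link_leaves)
                then show False using up(1) Nm not1 by blast
              qed
            qed
            then have "leaves (Z \<union> R) D h y" using leaves_avoid[OF e(1), of R] by blast
            then show ?thesis by (rule reach_leaves[OF _ Z_avoid(3)[OF F(1)]]) (rule Rdis, simp)
          qed (use Rdis in \<open>auto intro: reach_refl\<close>)
          show ?thesis using 1 2 by (rule reach_trans)
        qed
        show ?thesis
        proof (cases "p \<in> X")
          case False
          have "reach (N - ?F \<union> R0) D u p"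
            using False p star(1)[of p] uN R0(1) NZ F pN by (intro reach_step) auto
          then have "reach (N - ?F \<union> R0) D u y" using tail[OF R0(1)] R0(2) reach_trans by metis
          then show ?thesis using F by blast
        next
          case pX: True
          then have nuu: "\<not> link Z M u u" using Xu(1) by blast
          from Xl[OF pX] obtain a where a: "(u, a) \<in> D" "enters Z D a p" unfolding link_def by blast
          then obtain b where b: "reach Z D a b" "(b, p) \<in> D" unfolding enters_def by blast
          have aO: "a \<in> Out" using a(1) DM(1) reach_source[OF b(1)] by (intro Out_iff) auto
          obtain s where s: "s \<in> Out" "reach Z D a s" "reach (Z \<union> (Out - {s})) D s b"
            using reach_last[OF b(1) aO] by blast
          define R where "R = (Out - {s}) \<union> In"
          have RZ: "R \<inter> Z = {}" using nbrs_disjoint by (auto simp: R_def)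
          have sZ: "s \<notin> Z" "s \<notin> In" using nbrs_disjoint s(1) by (auto simp: Out_def In_def)
          have "\<not> (\<exists>t\<in>In - (Z \<union> (Out - {s})). reach (Z \<union> (Out - {s})) D s t \<and>
              reach (Z \<union> (Out - {s})) D t b)"
          proof
            assume "\<exists>t\<in>In - (Z \<union> (Out - {s})). reach (Z \<union> (Out - {s})) D s t \<and>
              reach (Z \<union> (Out - {s})) D t b"
            then obtain t where t: "t \<in> In" "reach (Z \<union> (Out - {s})) D s t" by blast
            have "reach Z D s t" by (rule reach_mono[OF t(2) _ subset_refl]) simp
            then have "leaves Z D u t" using kept[OF s(1)] by (auto simp: leaves_def)
            then have "link Z D u u" using kept'[OF t(1)] by (auto simp: link_leaves)
            then show False using nuu up(1) by blast
          qed
          then have "reach (Z \<union> R) D s b"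
            using reach_avoid[OF s(3), of In] by (auto simp: R_def Un_assoc)
          then have "enters (Z \<union> R) D s p" using b(2) by (auto simp: enters_def)
          then have 1: "reach (N - ?F \<union> R) D s p"
            by (rule enters_reach[OF _ Z_avoid(3)[OF F(1)]]) (use pN RZ NZ in auto)
          have 2: "reach (N - ?F \<union> R) D u s"
            using kept[OF s(1)] sZ RZ NZ uN by (intro reach_step) (auto simp: R_def)
          have 3: "reach (N - ?F \<union> R) D p y"
            by (rule tail[OF RZ]) (use kept kept' pX in \<open>auto simp: R_def\<close>)
          have "reach (N - ?F \<union> R) D u y" using 1 2 3 reach_trans by metis
          then show ?thesis using F nuu s(1) unfolding R_def by blast
        qed
      qed
    qed
  qed

  (* With a closed link at u, one out-neighbour is missed on both sides. Otherwise the way to u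
     misses all of Out and In, and the way from u misses Out or all but one of Out together with In. *)
  obtain R R0 where R: "R \<inter> Z = {}" "\<And>t. t \<in> R \<Longrightarrow> enters Z D t u \<or> (u, t) \<in> M \<and> \<not> link Z M u u"
    and R0: "R0 \<inter> Z = {}" "\<And>t. t \<in> R0 \<Longrightarrow> (u, t) \<in> D"
    and common: "\<And>R'. Out \<noteq> {} \<Longrightarrow> 2 \<le> card Out + card In \<Longrightarrow>
      R' = R0 \<or> \<not> link Z M u u \<and> (\<exists>s\<in>Out. R' = (Out - {s}) \<union> In) \<Longrightarrow> \<exists>r\<in>Out \<union> In. r \<in> R \<inter> R'"
  proof (cases "link Z M u u")
    case True
    then obtain s where s: "(u, s) \<in> D" "enters Z D s u" using loop unfolding link_def by blast
    have sZ: "s \<notin> Z" using s(2) by (auto simp: enters_def dest: reach_source)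
    then have "s \<in> Out" using s(1) DM(1) by (intro Out_iff) auto
    then show thesis using that[of "{s}" "{s}"] s sZ True by auto
  next
    case False
    show thesis
    proof (rule that[of "Out \<union> In" Out])
      show "(Out \<union> In) \<inter> Z = {}" "Out \<inter> Z = {}" using nbrs_disjoint by auto
      show "enters Z D t u \<or> (u, t) \<in> M \<and> \<not> link Z M u u" if "t \<in> Out \<union> In" for t
        using that False kept' nbrs_disjoint entersI[of t Z u D] by (auto simp: Out_def)
      show "(u, t) \<in> D" if "t \<in> Out" for t using kept that .
      show "\<exists>r\<in>Out \<union> In. r \<in> (Out \<union> In) \<inter> R'"
        if out: "Out \<noteq> {}" "2 \<le> card Out + card In"
          "R' = Out \<or> \<not> link Z M u u \<and> (\<exists>s\<in>Out. R' = (Out - {s}) \<union> In)" for R'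
      proof (cases "R' = Out")
        case False
        then obtain s where s: "s \<in> Out" "R' = (Out - {s}) \<union> In" using out(3) by blast
        have "R' \<noteq> {}"
        proof
          assume "R' = {}"
          then have "Out = {s}" "In = {}" using s by auto
          then show False using out(2) by simp
        qed
        then show ?thesis using s by blast
      qed (use out in auto)
    qed
  qed
  show ?thesis
  proof (intro exI[of _ D] conjI ballI D(1,2))
    fix x y assume xy: "x \<in> V" "y \<in> V"
    have tu: "(\<exists>F\<subseteq>N. card F \<le> 2 \<and> reach (N - F) D x u) \<or>
        (\<exists>F\<subseteq>N. card F \<le> 3 \<and> reach (N - F \<union> R) D x u)"
      by (rule to_u[OF xy(1) R])
    have fu: "(\<exists>F\<subseteq>N. card F \<le> 1 \<and> reach (N - F) D u y) \<or>
        (\<exists>F\<subseteq>N. card F \<le> 2 \<and> (\<exists>R. reach (N - F \<union> R) D u y \<and>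
          (R = R0 \<or> \<not> link Z M u u \<and> (\<exists>s\<in>Out. R = (Out - {s}) \<union> In))))"
      by (rule from_u[OF xy(2) R0])
    show "\<exists>F\<subseteq>N. card F \<le> 5 \<and> reach (N - F) D x y \<and>
       (Out \<noteq> {} \<and> 2 \<le> card Out + card In \<longrightarrow>
         card F \<le> 4 \<or> (\<exists>r\<in>Out \<union> In. reach (N - F \<union> {r}) D x y))"
      (is "\<exists>F\<subseteq>N. ?P F")
    proof -
      have combine: "\<exists>F\<subseteq>N. ?P F"
        if F: "F \<subseteq> N" "F' \<subseteq> N" "card F + card F' \<le> 4"
          "reach (N - F) D x u" "reach (N - F') D u y" for F F'
      proof -
        have "reach (N - (F \<union> F')) D x y"
          using reach_union[of F "{}" D x u F' "{}" y] F by simp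
        moreover have "card (F \<union> F') \<le> 4" using F(3) card_Un_le[of F F'] by linarith
        ultimately show ?thesis using F(1,2) by (intro exI[of _ "F \<union> F'"]) auto
      qed
      have drop: "reach (N - F) D a b" if "reach (N - F \<union> R') D a b" for F R' a b
        by (rule reach_mono[OF that _ subset_refl]) simp
      from fu consider (one) F' where "F' \<subseteq> N" "card F' \<le> 1" "reach (N - F') D u y"
        | (two) F' R' where "F' \<subseteq> N" "card F' \<le> 2" "reach (N - F' \<union> R') D u y"
            "R' = R0 \<or> \<not> link Z M u u \<and> (\<exists>s\<in>Out. R' = (Out - {s}) \<union> In)"
      proof (elim disjE[of "\<exists>F\<subseteq>N. card F \<le> 1 \<and> reach (N - F) D u y"] exE conjE, goal_cases)
        case (1 F')
        then show ?case by (intro 1(1)) auto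
      next
        case (2 F' R')
        then show ?case by (intro 2(2)) auto
      qed
      note fu = this
      from tu show ?thesis
      proof
        assume "\<exists>F\<subseteq>N. card F \<le> 2 \<and> reach (N - F) D x u"
        then obtain F where "F \<subseteq> N" "card F \<le> 2" "reach (N - F) D x u" by meson
        note F = this
        from fu show ?thesis
        proof cases
          case one
          then show ?thesis using combine[of F F'] F by simp
        next
          case two
          then show ?thesis using combine[of F F'] F drop[OF two(3)] by simp
        qed
      next
        assume "\<exists>F\<subseteq>N. card F \<le> 3 \<and> reach (N - F \<union> R) D x u"
        then obtain F where F: "F \<subseteq> N" "card F \<le> 3" "reach (N - F \<union> R) D x u" by meson
        from fu show ?thesis
        proof cases
          case one
          then show ?thesis using combine[of F F'] drop F by simp
        next
          case two
          note F = F two(1-3) and R' = two(4)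
        have r: "reach (N - (F \<union> F') \<union> (R \<inter> R')) D x y" by (rule reach_union[OF F(3,6)])
        have "card (F \<union> F') \<le> 5" using F card_Un_le[of F F'] by linarith
        moreover have "\<exists>r\<in>Out \<union> In. reach (N - (F \<union> F') \<union> {r}) D x y"
          if out: "Out \<noteq> {}" "2 \<le> card Out + card In"
        proof -
          obtain r' where r': "r' \<in> Out \<union> In" "r' \<in> R \<inter> R'" using common[OF out R'] by blast
          have "reach (N - (F \<union> F') \<union> {r'}) D x y" by (rule reach_mono[OF r _ subset_refl]) (use r' in auto)
          then show ?thesis using r' by blast
        qed
        ultimately show ?thesis using drop[OF r] F by (intro exI[of _ "F \<union> F'"]) auto
        qed
      qed
    qed
  qed
qed

lemma bounded_orientation_five: "bounded_orientation V A M (card A - card N + 5)"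
proof -
  obtain D where D: "orients D M" "D \<inter> D\<inverse> = {}"
    "\<forall>x\<in>V. \<forall>y\<in>V. \<exists>F\<subseteq>N. card F \<le> 5 \<and> reach (N - F) D x y"
    using mixed_routes by meson
  have "\<exists>Av. reach Av D x y \<and> card (A - Av) \<le> card A - card N + 5" if xy: "x \<in> V" "y \<in> V" for x y
  proof -
    obtain F where F: "F \<subseteq> N" "card F \<le> 5" "reach (N - F) D x y" using D(3) xy by meson
    then show ?thesis using card_A_bound(1)[OF F(1)] by (intro exI[of _ "N - F"]) simp
  qed
  then show ?thesis using D(1,2) unfolding bounded_orientation_def by blast
qed

text \<open>
  If five vertices of \<open>N\<close> are met, the missed vertex \<open>r\<close> compensates for the fifth.
\<close>

lemma bounded_orientation_four_out:
  assumes "Out \<noteq> {}" "2 \<le> card Out + card In"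
  shows "bounded_orientation V A M (card A - card N + 4)"
proof -
  obtain D where D: "orients D M" "D \<inter> D\<inverse> = {}"
    "\<forall>x\<in>V. \<forall>y\<in>V. \<exists>F\<subseteq>N. card F \<le> 5 \<and> reach (N - F) D x y \<and>
         (card F \<le> 4 \<or> (\<exists>r\<in>Out \<union> In. reach (N - F \<union> {r}) D x y))"
    using mixed_routes assms by meson
  have "\<exists>Av. reach Av D x y \<and> card (A - Av) \<le> card A - card N + 4" if xy: "x \<in> V" "y \<in> V" for x y
  proof -
    obtain F where F: "F \<subseteq> N" "card F \<le> 5" "reach (N - F) D x y"
         "card F \<le> 4 \<or> (\<exists>r\<in>Out \<union> In. reach (N - F \<union> {r}) D x y)" using D(3) xy by meson
    from F(4) show ?thesis
    proof
      assume "card F \<le> 4"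
      then show ?thesis using card_A_bound(1)[OF F(1)] F(3) by (intro exI[of _ "N - F"]) simp
    next
      assume "\<exists>r\<in>Out \<union> In. reach (N - F \<union> {r}) D x y"
      then obtain r where r: "r \<in> Out \<union> In" "reach (N - F \<union> {r}) D x y" by blast
      have "r \<in> A - N" using r nbrs_in_A by (auto simp: N_def Out_def In_def)
      then show ?thesis using card_A_bound(2)[OF F(1), of r] F(2) r(2)
        by (intro exI[of _ "N - F \<union> {r}"]) simp
    qed
  qed
  then show ?thesis using D(1,2) unfolding bounded_orientation_def by blast
qed

end

lemma (in mixed_star) bounded_orientation_four:
  assumes "2 \<le> card Out + card In"
  shows "bounded_orientation V A M (card A - card N + 4)"
proof (cases "Out = {}")
  case True
  interpret rev: mixed_star V A "M\<inverse>" u by (rule converse)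
  have "rev.N = N" "rev.Out = In" "rev.In = Out"
    by (auto simp: rev.N_def N_def rev.Out_def Out_def rev.In_def In_def)
  moreover have "In \<noteq> {}" using assms True by auto
  ultimately show ?thesis
    using rev.bounded_orientation_four_out bounded_orientation_converse assms by (simp add: add.commute)
next
  case False
  then show ?thesis using bounded_orientation_four_out assms by blast
qed

section \<open>Undirected bipartite graphs with a centre\<close>

locale undirected_star = mixed_star +
  assumes sym: "(x, y) \<in> M \<Longrightarrow> (y, x) \<in> M"
begin

text \<open>
  For \<open>x\<close> outside \<open>Z\<close>, these are the vertices of \<open>N\<close> adjacent to the component of \<open>x\<close> in the
  graph without \<open>Z\<close>. In particular, any two of them are linked.
\<close>

definition touches :: "'a \<Rightarrow> 'a set" where "touches x = {z \<in> Z. enters Z M x z}"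

text \<open>
  The union of the components outside \<open>Z\<close> that are attached to \<open>v\<close> alone. No walk between
  vertices outside it needs to enter it.
\<close>

definition pendant :: "'a \<Rightarrow> 'a set" where "pendant v = {x. x \<notin> Z \<and> touches x = {v}}"

lemma M_converse: "M\<inverse> = M" using sym by auto

lemma reach_sym: "reach S M x y \<Longrightarrow> reach S M y x"
  using reach_converse[of S M x y] by (simp add: M_converse)

lemma link_sym: "link Z M p q \<Longrightarrow> link Z M q p"
  using link_converse[of Z M p q] by (simp add: M_converse)

lemma enters_leaves: "enters Z M x z \<longleftrightarrow> leaves Z M z x"
  unfolding enters_def leaves_def by (meson reach_sym sym)

lemma u_nbr: "(b, u) \<in> M \<Longrightarrow> b \<in> N"
  using sym by (auto simp: N_def)

lemma not_enters_u: "\<not> enters Z M x u"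
  using u_nbr NZ reach_target by (fastforce simp: enters_def)

lemma not_leaves_u: "\<not> leaves Z M u y"
  using not_enters_u by (simp add: enters_leaves)

lemma in_Z_not_u: "h \<in> Z \<Longrightarrow> h \<noteq> u \<Longrightarrow> h \<in> N"
  by (simp add: Z_def)

lemma not_link_u: "\<not> link Z M p u"
  using not_enters_u by (auto simp: link_def)

lemma touches_N: "touches x \<subseteq> N"
  using not_enters_u by (auto simp: touches_def Z_def)

lemma touches_reach: assumes "reach Z M x y" shows "touches x = touches y"
  using reach_enters[OF assms] reach_enters[OF reach_sym[OF assms]] by (auto simp: touches_def)

lemma touches_ne: "x \<in> V \<Longrightarrow> x \<notin> Z \<Longrightarrow> touches x \<noteq> {}"
  using enters_Z[OF _ _ strong] by (auto simp: touches_def)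

lemma link_touches: "x \<notin> Z \<Longrightarrow> p \<in> touches x \<Longrightarrow> q \<in> touches x \<Longrightarrow> link Z M p q"
  unfolding touches_def enters_leaves by (auto intro: leaves_enters simp: enters_leaves)

lemma adjacent_neighbour:
  assumes "v \<in> N" shows "\<exists>w\<in>N. w \<noteq> v \<and> link Z M v w"
  using linked_neighbour[OF assms] not_link_u link_sym by blast

lemma maximal_independent:
  assumes "I0 \<subseteq> N" "\<And>p q. p \<in> I0 \<Longrightarrow> q \<in> I0 \<Longrightarrow> p \<noteq> q \<Longrightarrow> \<not> link Z M p q"
  obtains I where "I0 \<subseteq> I" "I \<subseteq> N" "\<And>p q. p \<in> I \<Longrightarrow> q \<in> I \<Longrightarrow> p \<noteq> q \<Longrightarrow> \<not> link Z M p q"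
    "\<And>v. v \<in> N - I \<Longrightarrow> \<exists>w\<in>I. link Z M v w"
proof -
  define ok where "ok I \<longleftrightarrow> I0 \<subseteq> I \<and> I \<subseteq> N \<and> (\<forall>p\<in>I. \<forall>q\<in>I. p \<noteq> q \<longrightarrow> \<not> link Z M p q)" for I
  have "ok I0" using assms by (auto simp: ok_def)
  moreover have "\<forall>I. ok I \<longrightarrow> card I < Suc (card N)"
    using finN by (auto simp: ok_def less_Suc_eq_le intro!: card_mono)
  ultimately obtain I where I: "ok I" and maxI: "\<forall>J. ok J \<longrightarrow> card J \<le> card I"
    using ex_has_greatest_nat[of ok I0 card "Suc (card N)"] by auto
  have "\<exists>w\<in>I. link Z M v w" if "v \<in> N - I" for v
  proof (rule ccontr)
    assume "\<not> ?thesis"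
    then have "ok (insert v I)" using I that link_sym by (auto simp: ok_def)
    moreover have "finite I" using I finN finite_subset by (auto simp: ok_def)
    ultimately show False using maxI[rule_format, of "insert v I"] that by simp
  qed
  then show thesis using that[of I] I by (auto simp: ok_def)
qed

text \<open>
  For a maximal independent set \<open>I\<close> of the symmetric link relation, every vertex of \<open>N - I\<close> is linked
  to \<open>I\<close>, and every vertex of \<open>I\<close> from \<open>N - I\<close>. All demands lead from \<open>N - I\<close> to \<open>I\<close>, and after an
  exchange of tails the source of one and the target of the other still fit. This also
  tolerates one further demand between two given vertices, held by \<open>Extra\<close>. The orientation
  may start from a relation \<open>C0\<close> in which more edges than those at \<open>u\<close> have been directed.
\<close>

lemma independent_orientation:
  assumes I: "I \<subseteq> N" "\<And>p q. p \<in> I \<Longrightarrow> q \<in> I \<Longrightarrow> p \<noteq> q \<Longrightarrow> \<not> link Z M p q"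
    "\<And>v. v \<in> N - I \<Longrightarrow> \<exists>w\<in>I. link Z M v w"
    and C0: "orients C0 (star I)" "\<And>v w. v \<in> N - I \<Longrightarrow> link Z M v w \<Longrightarrow> link Z C0 v w"
    "\<And>x h. enters Z M x h \<Longrightarrow> enters Z C0 x h"
    "\<And>y. y \<in> V - Z \<Longrightarrow> \<exists>h\<in>Z. leaves Z C0 h y"
    and ex: "Extra = {} \<or> Extra = {({p0}, {q0})} \<and> p0 \<in> N - I \<and> q0 \<in> I \<and> link Z M p0 q0"
  obtains D where "orients D C0" "orients D M" "D \<inter> D\<inverse> = {}" "V \<times> V \<subseteq> D\<^sup>*"
    "\<And>v. v \<in> N - I \<Longrightarrow> (u, v) \<in> D" "\<And>w. w \<in> I \<Longrightarrow> (w, u) \<in> D"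
    "\<And>v. v \<in> N - I \<Longrightarrow> \<exists>w\<in>I. link Z D v w" "\<And>w. w \<in> I \<Longrightarrow> \<exists>v\<in>N - I. link Z D v w"
    "Extra \<noteq> {} \<Longrightarrow> link Z D p0 q0"
proof -
  have into: "\<exists>v\<in>N - I. link Z M v w" if w: "w \<in> I" for w
  proof -
    obtain v where v: "v \<in> N" "v \<noteq> w" "link Z M w v" using adjacent_neighbour[of w] w I(1) by blast
    then have "v \<notin> I" using I(2)[OF w, of v] by blast
    then show ?thesis using v link_sym by blast
  qed
  define Dm where "Dm = (\<lambda>v. ({v}, I)) ` (N - I) \<union> (\<lambda>w. (N - I, {w})) ` I \<union> Extra"
  have sat_iff: "(\<forall>d\<in>Dm. sat Z C d) \<longleftrightarrow> (\<forall>v\<in>N - I. \<exists>w\<in>I. link Z C v w) \<and>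
      (\<forall>w\<in>I. \<exists>v\<in>N - I. link Z C v w) \<and> (Extra \<noteq> {} \<longrightarrow> link Z C p0 q0)" for C
    unfolding Dm_def using ex by (auto simp: ball_Un sat_def)
  have span: "Z \<times> Z \<subseteq> C\<^sup>*" if C: "orients C (star I)" "\<forall>d\<in>Dm. sat Z C d" for C
  proof -
    note s = C(2)[unfolded sat_iff]
    have 1: "w \<in> I \<Longrightarrow> (w, u) \<in> C\<^sup>*" "v \<in> N - I \<Longrightarrow> (u, v) \<in> C\<^sup>*" for v w
      using star_arcs[OF I(1) C(1)] by auto
    have 2: "(v, u) \<in> C\<^sup>*" if "v \<in> N" for v
      using s 1 that link_rtrancl rtrancl_trans by (metis DiffI)
    have 3: "(u, w) \<in> C\<^sup>*" if "w \<in> N" for w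
      using s 1 that link_rtrancl rtrancl_trans by (metis DiffI)
    show ?thesis using 2 3 unfolding Z_def by (auto intro: rtrancl_trans)
  qed
  have sat0: "\<forall>d\<in>Dm. sat Z C0 d" unfolding sat_iff using I(3) into C0(2) ex by blast
  have strong0: "V \<times> V \<subseteq> C0\<^sup>*"
  proof (rule strong_via_Z)
    show "\<exists>h\<in>Z. enters Z C0 x h" if "x \<in> V - Z" for x
      using enters_Z[OF _ _ strong] C0(3) that by blast
  qed (use C0(4) span[OF C0(1) sat0] in auto)
  have mem: "p \<in> N - I \<and> q \<in> I \<and> ((P = {p} \<and> Q = I) \<or> (P = N - I \<and> Q = {q}) \<or>
      (P = {p0} \<and> Q = {q0} \<and> p = p0 \<and> q = q0))"
    if "(P, Q) \<in> Dm" "p \<in> P" "q \<in> Q" for P Q p q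
    using that ex unfolding Dm_def by auto
  obtain D where D: "orients D C0" "D \<inter> D\<inverse> = {}" "V \<times> V \<subseteq> D\<^sup>*" "\<forall>d\<in>Dm. sat Z D d"
  proof (rule star_orientation_with_links[OF I(1) C0(1) strong0, of Dm])
    show "P \<subseteq> Z \<and> Q \<subseteq> Z \<and> P \<inter> Q \<subseteq> {u}" if "(P, Q) \<in> Dm" for P Q
      using that ex I(1) unfolding Dm_def Z_def by auto
    show "sat Z C0 d" if "d \<in> Dm" for d using sat0 that by blast
    show "Z \<times> Z \<subseteq> C\<^sup>*" if "orients C C0" "\<forall>d\<in>Dm. sat Z C d" for C
      by (rule span[OF orients_trans[OF that(1) C0(1)] that(2)])
    show "sat Z C (P1, Q1) \<or> sat Z C (P2, Q2)"
      if "(P1, Q1) \<in> Dm" "(P2, Q2) \<in> Dm" "p1 \<in> P1" "q1 \<in> Q1" "p2 \<in> P2" "q2 \<in> Q2"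
        and l: "link Z C p1 q2 \<or> p1 = q2 \<and> p1 \<noteq> u" "link Z C p2 q1 \<or> p2 = q1 \<and> p2 \<noteq> u"
      for C P1 Q1 P2 Q2 p1 q1 p2 q2
    proof -
      note m = mem[OF that(1,3,4)] mem[OF that(2,5,6)]
      have "link Z C p1 q2" "link Z C p2 q1" using l m by auto
      then show ?thesis using m unfolding sat_def by auto
    qed
  qed blast
  note s = D(4)[unfolded sat_iff]
  have DS: "orients D (star I)" using orients_trans[OF D(1) C0(1)] .
  show thesis
    by (rule that[of D]) (use D s star_arcs[OF I(1) DS] orients_trans[OF DS orients_star[OF I(1)]] in auto)
qed

text \<open>
  A link between two different vertices cannot pass through a pendant part, and an initial or
  final segment outside \<open>Z\<close> stays in its component. Hence a pendant part that contains neither end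
  can be avoided.
\<close>

lemma undirected_routes:
  assumes I: "I \<subseteq> N"
    and D: "D \<subseteq> M" "V \<times> V \<subseteq> D\<^sup>*"
    and star: "\<And>v. v \<in> N - I \<Longrightarrow> (u, v) \<in> D" "\<And>w. w \<in> I \<Longrightarrow> (w, u) \<in> D"
    and links: "\<And>v. v \<in> N - I \<Longrightarrow> \<exists>w\<in>I. link Z D v w" "\<And>w. w \<in> I \<Longrightarrow> \<exists>v\<in>N - I. link Z D v w"
    and R: "R = {} \<or> R = pendant z" and x: "x \<in> V" "x \<notin> R"
  shows "\<exists>F\<subseteq>N. card F \<le> 2 \<and> reach (N - F \<union> R) D x u"
    and "\<exists>F\<subseteq>N. card F \<le> 2 \<and> reach (N - F \<union> R) D u x"
proof -
  have RZ: "R \<inter> Z = {}" using R by (auto simp: pendant_def)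
  have closed: "t' \<in> R" if "t \<in> R" "reach Z M t t'" for t t'
    using R that touches_reach[OF that(2)] reach_target[OF that(2)] by (auto simp: pendant_def)
  have up: "reach Z D p q \<Longrightarrow> reach Z M p q" "enters Z D p q \<Longrightarrow> enters Z M p q"
    "leaves Z D p q \<Longrightarrow> leaves Z M p q" for p q
    using reach_mono enters_mono leaves_mono D(1) by (metis subset_refl)+
  have lk: "reach (N - F \<union> R) D p q"
    if l: "link Z D p q" "p \<noteq> q" "p \<in> F" "q \<in> F" "F \<subseteq> N" for F p q
  proof -
    have "\<not> (\<exists>t\<in>R - Z. leaves Z D p t \<and> enters Z D t q)"
    proof
      assume "\<exists>t\<in>R - Z. leaves Z D p t \<and> enters Z D t q"
      then obtain t where t: "t \<in> R" "leaves Z D p t" "enters Z D t q" by blast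
      then have "p \<in> touches t" "q \<in> touches t"
        using up l NZ by (auto simp: touches_def enters_leaves)
      then show False using R t(1) l(2) by (auto simp: pendant_def)
    qed
    then have "link (Z \<union> R) D p q" using link_avoid[OF l(1), of R] by blast
    then show ?thesis
      by (rule link_reach[OF _ Z_avoid(3)[OF l(5)]]) (use l NZ RZ in auto)
  qed
  have u_ok: "u \<notin> N - F \<union> R" for F using uN RZ NZ by auto
  have h_ok: "h \<notin> N - F \<union> R" if "h \<in> F" "h \<in> N" for h F using that RZ NZ by auto
  have st: "reach (N - F \<union> R) D w u" if "w \<in> I" "w \<in> F" for F w
    using reach_step[OF star(2)[OF that(1)] h_ok[OF that(2)] u_ok] I that by blast
  have st': "reach (N - F \<union> R) D u v" if "v \<in> N - I" "v \<in> F" for F v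
    using reach_step[OF star(1)[OF that(1)] u_ok h_ok[OF that(2)]] that by blast
  have hub: "\<exists>F\<subseteq>N. h \<in> F \<and> card F \<le> 2 \<and> reach (N - F \<union> R) D h u" if h: "h \<in> N" for h
  proof (cases "h \<in> I")
    case True
    then show ?thesis using st[of h "{h}"] h by (intro exI[of _ "{h}"]) simp
  next
    case False
    then obtain w where w: "w \<in> I" "link Z D h w" using links(1)[of h] h by blast
    have "reach (N - {h, w} \<union> R) D h w" using lk[OF w(2), of "{h, w}"] w False h I by auto
    then have "reach (N - {h, w} \<union> R) D h u" using st[of w "{h, w}"] w(1) by (blast intro: reach_trans)
    then show ?thesis using w I h by (intro exI[of _ "{h, w}"]) (auto simp: card_insert_if)
  qed
  have hub': "\<exists>F\<subseteq>N. h \<in> F \<and> card F \<le> 2 \<and> reach (N - F \<union> R) D u h" if h: "h \<in> N" for h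
  proof (cases "h \<in> I")
    case False
    then show ?thesis using st'[of h "{h}"] h by (intro exI[of _ "{h}"]) simp
  next
    case True
    then obtain v where v: "v \<in> N - I" "link Z D v h" using links(2)[of h] by blast
    have "reach (N - {v, h} \<union> R) D v h" using lk[OF v(2), of "{v, h}"] v True h by auto
    then have "reach (N - {v, h} \<union> R) D u h" using st'[of v "{v, h}"] v(1) by (blast intro: reach_trans)
    then show ?thesis using v h by (intro exI[of _ "{v, h}"]) (auto simp: card_insert_if)
  qed
  show "\<exists>F\<subseteq>N. card F \<le> 2 \<and> reach (N - F \<union> R) D x u"
  proof (cases "x \<in> Z")
    case True
    show ?thesis
    proof (cases "x = u")
      case True
      then show ?thesis using reach_refl[OF u_ok[of "{}"], of D] by (intro exI[of _ "{}"]) simp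
    next
      case False
      then have "x \<in> N" using \<open>x \<in> Z\<close> by (simp add: Z_def)
      then show ?thesis using hub by meson
    qed
  next
    case False
    then obtain h where h: "h \<in> Z" "enters Z D x h" using enters_Z[OF x(1) _ D(2)] by blast
    then have "h \<in> N" using not_enters_u up(2) in_Z_not_u by metis
    then obtain F where F: "F \<subseteq> N" "h \<in> F" "card F \<le> 2" "reach (N - F \<union> R) D h u" using hub by blast
    have "\<not> (\<exists>t\<in>R - Z. reach Z D x t \<and> enters Z D t h)"
      by (meson DiffD1 closed up(1) reach_sym x(2))
    then have "enters (Z \<union> R) D x h" using enters_avoid[OF h(2), of R] by blast
    then have "reach (N - F \<union> R) D x h"
      by (rule enters_reach[OF _ Z_avoid(3)[OF F(1)]]) (rule h_ok[OF F(2) \<open>h \<in> N\<close>])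
    then show ?thesis using F reach_trans by metis
  qed
  show "\<exists>F\<subseteq>N. card F \<le> 2 \<and> reach (N - F \<union> R) D u x"
  proof (cases "x \<in> Z")
    case True
    show ?thesis
    proof (cases "x = u")
      case True
      then show ?thesis using reach_refl[OF u_ok[of "{}"], of D] by (intro exI[of _ "{}"]) simp
    next
      case False
      then have "x \<in> N" using \<open>x \<in> Z\<close> by (simp add: Z_def)
      then show ?thesis using hub' by meson
    qed
  next
    case False
    then obtain h where h: "h \<in> Z" "leaves Z D h x" using leaves_Z[OF x(1) _ D(2)] by blast
    then have "h \<in> N" using not_leaves_u up(3) in_Z_not_u by metis
    then obtain F where F: "F \<subseteq> N" "h \<in> F" "card F \<le> 2" "reach (N - F \<union> R) D u h" using hub' by blast
    have "\<not> (\<exists>t\<in>R - Z. leaves Z D h t \<and> reach Z D t x)"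
      by (meson DiffD1 closed up(1) x(2))
    then have "leaves (Z \<union> R) D h x" using leaves_avoid[OF h(2), of R] by blast
    then have "reach (N - F \<union> R) D h x"
      by (rule reach_leaves[OF _ Z_avoid(3)[OF F(1)]]) (rule h_ok[OF F(2) \<open>h \<in> N\<close>])
    then show ?thesis using F reach_trans by metis
  qed
qed

text \<open>
  An edge between \<open>v\<close> and the pendant part is not a bridge, so its end \<open>b\<close> in the pendant part
  has a second neighbour. It lies in \<open>A\<close> like \<open>v\<close>, and being no vertex of \<open>N\<close> it belongs to the
  pendant part as well.
\<close>

lemma pendant_in_A:
  assumes "pendant v \<noteq> {}"
  shows "v \<in> N" "\<exists>a\<in>A - N. a \<in> pendant v"
proof -
  obtain x where x: "x \<notin> Z" "touches x = {v}" using assms by (auto simp: pendant_def)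
  show vN: "v \<in> N" using touches_N[of x] x by auto
  have "enters Z M x v" using x(2) by (auto simp: touches_def)
  then obtain b where b: "reach Z M x b" "(b, v) \<in> M" unfolding enters_def by blast
  have bZ: "b \<notin> Z" "touches b = {v}" using reach_target[OF b(1)] touches_reach[OF b(1)] x by auto
  have vA: "v \<in> A" "b \<notin> A" using vN nbrs_in_A bip[OF b(2)] by auto
  have "(b, v) \<in> ((M \<union> M\<inverse>) - {(b, v), (v, b)})\<^sup>*" using nobridge b(2) sym by blast
  moreover have "b \<noteq> v" using vA by auto
  ultimately obtain a where "(b, a) \<in> (M \<union> M\<inverse>) - {(b, v), (v, b)}"
    by (meson converse_rtranclE)
  then have a: "(b, a) \<in> M" "a \<noteq> v" using sym by auto
  have aA: "a \<in> A" using bip[OF a(1)] vA by auto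
  have "a \<notin> Z"
  proof
    assume "a \<in> Z"
    then have "a \<in> touches b" using entersI[OF bZ(1) a(1)] by (simp add: touches_def)
    then show False using bZ a by auto
  qed
  moreover from this have "touches a = {v}"
    using touches_reach[OF reach_step[OF a(1) bZ(1)]] bZ(2) by simp
  ultimately show "\<exists>a\<in>A - N. a \<in> pendant v"
    using aA NZ by (intro bexI[of _ a]) (auto simp: pendant_def)
qed

text \<open>
  Both alternatives give paths of length at most \<open>2 * (card A - card N) + 7\<close>: a path that ends in
  \<open>A\<close> is one shorter than twice the number of its vertices in \<open>A\<close>.
\<close>

definition tight_route :: "'a rel \<Rightarrow> 'a \<Rightarrow> 'a \<Rightarrow> bool" where
  "tight_route D x y \<longleftrightarrow> (\<exists>Av. reach Av D x y \<and> (card (A - Av) \<le> card A - card N + 3 \<or>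
     y \<in> A \<and> card (A - Av) \<le> card A - card N + 4))"

lemma tight_route3:
  assumes "F \<subseteq> N" "card F \<le> 3" "reach (N - F) D x y" shows "tight_route D x y"
  using card_A_bound(1)[OF assms(1)] assms unfolding tight_route_def
  by (intro exI[of _ "N - F"]) simp

text \<open>
  The independent set \<open>I\<close> is chosen without the vertex that carries the pendant part, if there is
  one. Then every component outside \<open>Z\<close> touches a vertex of \<open>N - I\<close>: of two vertices that it touches
  at most one is in \<open>I\<close>, and if it touches a single vertex, it is pendant there. All edges between \<open>I\<close> and the outside of \<open>Z\<close> can thus be directed
  towards \<open>I\<close> (relation \<open>C0\<close>), and the outside remains reachable. As a consequence, routes from
  \<open>u\<close> to a vertex outside \<open>N\<close> contain at most one vertex of \<open>N\<close>, which belongs to \<open>N - I\<close>. Two are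
  needed only if the route ends in \<open>I\<close>, a subset of \<open>A\<close>.
\<close>

lemma tight_orientation_one_pendant:
  assumes few: "\<And>v w. pendant v \<noteq> {} \<Longrightarrow> pendant w \<noteq> {} \<Longrightarrow> v = w"
  shows "\<exists>D. orients D M \<and> D \<inter> D\<inverse> = {} \<and> (\<forall>x\<in>V. \<forall>y\<in>V. tight_route D x y)"
proof -
  obtain I where I: "I \<subseteq> N" "\<And>p q. p \<in> I \<Longrightarrow> q \<in> I \<Longrightarrow> p \<noteq> q \<Longrightarrow> \<not> link Z M p q"
    "\<And>v. v \<in> N - I \<Longrightarrow> \<exists>w\<in>I. link Z M v w" and nopend: "\<And>v. v \<in> I \<Longrightarrow> pendant v = {}"
  proof (cases "\<exists>v. pendant v \<noteq> {}")
    case False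
    obtain I where "I \<subseteq> N" "\<And>p q. p \<in> I \<Longrightarrow> q \<in> I \<Longrightarrow> p \<noteq> q \<Longrightarrow> \<not> link Z M p q"
      "\<And>v. v \<in> N - I \<Longrightarrow> \<exists>w\<in>I. link Z M v w" by (rule maximal_independent[of "{}"]) auto
    then show thesis using that[of I] False by blast
  next
    case True
    then obtain v where v: "pendant v \<noteq> {}" by blast
    obtain w where w: "w \<in> N" "w \<noteq> v" "link Z M v w"
      using adjacent_neighbour[OF pendant_in_A(1)[OF v]] by blast
    obtain I where I: "{w} \<subseteq> I" "I \<subseteq> N" "\<And>p q. p \<in> I \<Longrightarrow> q \<in> I \<Longrightarrow> p \<noteq> q \<Longrightarrow> \<not> link Z M p q"
      "\<And>v. v \<in> N - I \<Longrightarrow> \<exists>w\<in>I. link Z M v w"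
      by (rule maximal_independent[of "{w}"]) (use w in auto)
    have "v \<notin> I" using I(3)[of v w] I(1) w by auto
    then have "\<And>z. z \<in> I \<Longrightarrow> pendant z = {}" using few[OF v] by metis
    then show thesis using that[of I] I by blast
  qed
  define C0 where "C0 = star I - {(w, y). w \<in> I \<and> y \<notin> Z}"
  have C0_iff: "(x, y) \<in> C0 \<longleftrightarrow> (x, y) \<in> M \<and> x \<notin> I" if "x \<notin> Z \<or> y \<notin> Z" for x y
    using that star_outside[OF that I(1)] I(1) by (auto simp: C0_def Z_def)
  have C0s: "orients C0 (star I)"
  proof -
    have "(y, x) \<in> C0" if "(x, y) \<in> star I" "(x, y) \<notin> C0" for x y
      using that C0_iff[of y x] star_outside[of x y I] sym I(1) by (auto simp: C0_def Z_def)
    then show ?thesis by (auto simp: orients_def C0_def)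
  qed
  have inner0: "inner Z C0 = inner Z M" using C0_iff I(1) by (auto simp: inner_def Z_def)
  then have reach0: "reach Z C0 x y \<longleftrightarrow> reach Z M x y" for x y by (simp add: reach_def)
  have enters0: "enters Z C0 x h" if l: "enters Z M x h" for x h
  proof -
    obtain b where b: "reach Z M x b" "(b, h) \<in> M" using l by (auto simp: enters_def)
    then show ?thesis using C0_iff[of b h] reach_target[OF b(1)] I(1) NZ reach0
      unfolding enters_def by blast
  qed
  have leaves0: "leaves Z C0 h y" if l: "leaves Z M h y" "h \<notin> I" for h y
  proof -
    obtain b where b: "reach Z M b y" "(h, b) \<in> M" using l by (auto simp: leaves_def)
    then show ?thesis using C0_iff[of h b] reach_source[OF b(1)] l(2) reach0
      unfolding leaves_def by blast
  qed
  have leaves1: "h \<notin> I" if "leaves Z C0 h y" for h y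
    using that C0_iff reach_source unfolding leaves_def by metis
  have link0: "link Z C0 v w" if l: "v \<in> N - I" "link Z M v w" for v w
  proof -
    obtain b where "leaves Z M v b" "(b, w) \<in> M" using l by (auto simp: link_leaves)
    moreover from this(1) have "b \<notin> Z" by (auto simp: leaves_def dest: reach_target)
    ultimately show ?thesis
      using leaves0[of v b] C0_iff[of b w] l(1) I(1) NZ unfolding link_leaves by blast
  qed
  have cover: "\<exists>h\<in>Z. leaves Z C0 h y" if y: "y \<in> V - Z" for y
  proof -
    obtain v where v: "v \<in> touches y" using touches_ne[of y] y by auto
    have "\<exists>h\<in>touches y. h \<notin> I"
    proof (rule ccontr)
      assume a: "\<not> ?thesis"
      then have "touches y = {v}" using v I(2) link_touches[of y] y by blast
      then have "pendant v \<noteq> {}" using y by (auto simp: pendant_def)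
      then show False using nopend[of v] a v by blast
    qed
    then show ?thesis using leaves0 by (auto simp: touches_def enters_leaves)
  qed
  obtain D where D: "orients D C0" "orients D M" "D \<inter> D\<inverse> = {}" "V \<times> V \<subseteq> D\<^sup>*"
    "\<And>v. v \<in> N - I \<Longrightarrow> (u, v) \<in> D" "\<And>w. w \<in> I \<Longrightarrow> (w, u) \<in> D"
    "\<And>v. v \<in> N - I \<Longrightarrow> \<exists>w\<in>I. link Z D v w" "\<And>w. w \<in> I \<Longrightarrow> \<exists>v\<in>N - I. link Z D v w"
    by (rule independent_orientation[OF I C0s link0 enters0 cover, of "{}"]; (assumption | simp)?)
  have DM: "D \<subseteq> M" "D \<subseteq> C0" using D by (auto simp: orients_def)
  note routes = undirected_routes[OF I(1) DM(1) D(4-8), of "{}", simplified]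
  have "tight_route D x y" if x: "x \<in> V" and y: "y \<in> V" for x y
  proof -
    obtain F where F: "F \<subseteq> N" "card F \<le> 2" "reach (N - F) D x u" using routes(1)[OF x] by blast
    have glue: "reach (N - (F \<union> F')) D x y \<and> card (F \<union> F') \<le> 2 + card F'"
      if "reach (N - F') D u y" for F'
      using reach_union[of F "{}" D x u F' "{}" y] F that card_Un_le[of F F'] by simp
    show ?thesis
    proof (cases "y \<in> N")
      case True
      obtain F' where F': "F' \<subseteq> N" "card F' \<le> 2" "reach (N - F') D u y" using routes(2)[OF y] by blast
      have "F \<union> F' \<subseteq> N" using F F' by auto
      from card_A_bound(1)[OF this] glue[OF F'(3)] F'(2) True nbrs_in_A show ?thesis
        unfolding tight_route_def by (intro exI[of _ "N - (F \<union> F')"]) auto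
    next
      case False
      have "\<exists>F'\<subseteq>N. card F' \<le> 1 \<and> reach (N - F') D u y"
      proof (cases "y = u")
        case True
        then show ?thesis using uN by (intro exI[of _ "{}"]) (simp add: reach_refl)
      next
        case y_u: False
        then have yZ: "y \<notin> Z" using False by (auto simp: Z_def)
        then obtain h where h: "h \<in> Z" "leaves Z D h y" using leaves_Z[OF y _ D(4)] by blast
        have "h \<notin> I" using leaves1 leaves_mono[OF h(2) subset_refl DM(2)] by blast
        moreover have "h \<in> N"
          using h leaves_mono[OF h(2) subset_refl DM(1)] not_leaves_u in_Z_not_u by metis
        ultimately have "(u, h) \<in> D" "h \<in> N" using D(5) by auto
        moreover from this have "reach (N - {h}) D u h" using uN by (intro reach_step) auto
        moreover have "reach (N - {h}) D h y" using NZ by (intro reach_leaves[OF h(2)]) auto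
        ultimately show ?thesis by (intro exI[of _ "{h}"]) (auto intro: reach_trans)
      qed
      then obtain F' where F': "F' \<subseteq> N" "card F' \<le> 1" "reach (N - F') D u y" by blast
      show ?thesis using tight_route3[of "F \<union> F'"] glue[OF F'(3)] F F' by simp
    qed
  qed
  then show ?thesis using D(2,3) by blast
qed

text \<open>
  If \<open>x\<close> and \<open>y\<close> both lie outside one of the two pendant parts, the walk avoids this part and
  with it a vertex of \<open>A\<close> (\<open>pendant_in_A\<close>), which compensates for the fourth vertex of \<open>N\<close>.
  Otherwise one of \<open>x\<close> and \<open>y\<close> lies in either part. If \<open>v1\<close> and \<open>v2\<close> are not linked, both are put
  into \<open>I\<close>, and the route from \<open>x\<close> to \<open>u\<close> meets only one vertex of \<open>N\<close>. If they are linked, only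
  \<open>v1\<close> can be put into \<open>I\<close>; the direct link from \<open>v2\<close> to \<open>v1\<close> is then demanded in addition, and it
  serves the walks from the part at \<open>v2\<close> to the part at \<open>v1\<close>.
\<close>

lemma tight_orientation_two_pendants:
  assumes v: "v1 \<noteq> v2" "pendant v1 \<noteq> {}" "pendant v2 \<noteq> {}"
  shows "\<exists>D. orients D M \<and> D \<inter> D\<inverse> = {} \<and> (\<forall>x\<in>V. \<forall>y\<in>V. tight_route D x y)"
proof -
  have vN: "v1 \<in> N" "v2 \<in> N" using pendant_in_A(1) v by auto
  define adj where "adj \<longleftrightarrow> link Z M v1 v2"
  obtain I where I0: "(if adj then {v1} else {v1, v2}) \<subseteq> I"
    and I: "I \<subseteq> N" "\<And>p q. p \<in> I \<Longrightarrow> q \<in> I \<Longrightarrow> p \<noteq> q \<Longrightarrow> \<not> link Z M p q"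
    "\<And>v. v \<in> N - I \<Longrightarrow> \<exists>w\<in>I. link Z M v w"
    by (rule maximal_independent[of "if adj then {v1} else {v1, v2}"])
      (use vN link_sym in \<open>auto simp: adj_def split: if_splits\<close>)
  have v1I: "v1 \<in> I" and v2I: "\<not> adj \<Longrightarrow> v2 \<in> I" using I0 by (auto split: if_splits)
  have v2I': "adj \<Longrightarrow> v2 \<in> N - I" using I(2)[of v1 v2] v1I v(1) vN by (auto simp: adj_def)
  define Extra where "Extra = (if adj then {({v2}, {v1})} else {})"
  have ex: "Extra = {} \<or> Extra = {({v2}, {v1})} \<and> v2 \<in> N - I \<and> v1 \<in> I \<and> link Z M v2 v1"
    using v1I v2I' link_sym by (auto simp: Extra_def adj_def)
  have cover: "\<exists>h\<in>Z. leaves Z (star I) h y" if "y \<in> V - Z" for y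
    using leaves_Z[OF _ _ strong] that by (auto simp: leaves_star[OF I(1)])
  obtain D where D: "orients D (star I)" "orients D M" "D \<inter> D\<inverse> = {}" "V \<times> V \<subseteq> D\<^sup>*"
    "\<And>v. v \<in> N - I \<Longrightarrow> (u, v) \<in> D" "\<And>w. w \<in> I \<Longrightarrow> (w, u) \<in> D"
    "\<And>v. v \<in> N - I \<Longrightarrow> \<exists>w\<in>I. link Z D v w" "\<And>w. w \<in> I \<Longrightarrow> \<exists>v\<in>N - I. link Z D v w"
    "Extra \<noteq> {} \<Longrightarrow> link Z D v2 v1"
    by (rule independent_orientation[OF I _ _ _ cover ex])
      (simp_all add: orients_def link_star[OF I(1)] enters_star[OF I(1)])
  have DM: "D \<subseteq> M" using D by (auto simp: orients_def)
  note routes = undirected_routes[OF I(1) DM D(4-8)]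
  (* The vertex a of the pendant part at z is missed. *)
  have miss: "tight_route D x y"
    if z: "z = v1 \<or> z = v2" and xy: "x \<in> V" "y \<in> V" "x \<notin> pendant z" "y \<notin> pendant z" for x y z
  proof -
    obtain a where a: "a \<in> A - N" "a \<in> pendant z" using pendant_in_A(2) z v by blast
    obtain F where F: "F \<subseteq> N" "card F \<le> 2" "reach (N - F \<union> pendant z) D x u"
      using routes(1)[of "pendant z" z x] xy by blast
    obtain F' where F': "F' \<subseteq> N" "card F' \<le> 2" "reach (N - F' \<union> pendant z) D u y"
      using routes(2)[of "pendant z" z y] xy by blast
    have "reach (N - (F \<union> F') \<union> (pendant z \<inter> pendant z)) D x y" by (rule reach_union[OF F(3) F'(3)])
    then have "reach (N - (F \<union> F') \<union> {a}) D x y"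
      by (rule reach_mono[OF _ _ subset_refl]) (use a in auto)
    moreover have "card (A - (N - (F \<union> F') \<union> {a})) + 1 \<le> card A - card N + card (F \<union> F')"
      using card_A_bound(2)[of "F \<union> F'" a] F F' a by auto
    moreover have "card (F \<union> F') \<le> 4" using card_Un_le[of F F'] F F' by linarith
    ultimately show ?thesis unfolding tight_route_def by (intro exI[of _ "N - (F \<union> F') \<union> {a}"]) auto
  qed
  have pin: "reach (N - F) D x z" if z: "x \<in> V" "x \<in> pendant z" "z \<in> F" for x z F
  proof -
    have "x \<notin> Z" using z by (simp add: pendant_def)
    then obtain h where h: "h \<in> Z" "enters Z D x h" using enters_Z[OF z(1) _ D(4)] by blast
    then have "h = z"
      using enters_mono[OF h(2) subset_refl DM] z by (auto simp: pendant_def touches_def)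
    then show ?thesis using enters_reach[OF h(2), of "N - F"] z NZ by auto
  qed
  have pout: "reach (N - F) D z y" if z: "y \<in> V" "y \<in> pendant z" "z \<in> F" for y z F
  proof -
    have "y \<notin> Z" using z by (simp add: pendant_def)
    then obtain h where h: "h \<in> Z" "leaves Z D h y" using leaves_Z[OF z(1) _ D(4)] by blast
    then have "h = z"
      using leaves_mono[OF h(2) subset_refl DM] z by (auto simp: pendant_def touches_def enters_leaves)
    then show ?thesis using reach_leaves[OF h(2), of "N - F"] z NZ by auto
  qed
  have stI: "reach (N - F) D w u" if "w \<in> I" "w \<in> F" for w F
    using D(6)[OF that(1)] that uN by (intro reach_step) auto
  (* From the pendant part at a vertex of I, a single vertex of N is met on the way to u. *)
  have via_u: "tight_route D x y" if z: "x \<in> V" "y \<in> V" "x \<in> pendant z" "z \<in> I" for x y z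
  proof -
    obtain F where F: "F \<subseteq> N" "card F \<le> 2" "reach (N - F) D u y"
      using routes(2)[of "{}" z y] z by auto
    have "reach (N - {z}) D x u" using pin[OF z(1,3), of "{z}"] stI[OF z(4), of "{z}"]
      by (auto intro: reach_trans)
    then have "reach (N - ({z} \<union> F)) D x y" using reach_union[of "{z}" "{}" D x u F "{}" y] F by simp
    moreover have "card ({z} \<union> F) \<le> 3" using card_Un_le[of "{z}" F] F by simp
    ultimately show ?thesis using tight_route3[of "{z} \<union> F"] F z I(1) by auto
  qed
  have "tight_route D x y" if xy: "x \<in> V" "y \<in> V" for x y
  proof -
    have disj: "pendant v1 \<inter> pendant v2 = {}" using v(1) by (auto simp: pendant_def)
    consider "x \<notin> pendant v1" "y \<notin> pendant v1" | "x \<notin> pendant v2" "y \<notin> pendant v2"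
      | "x \<in> pendant v1" "y \<in> pendant v2" | "x \<in> pendant v2" "y \<in> pendant v1"
      using disj by blast
    then show ?thesis
    proof cases
      case 3
      then show ?thesis using via_u[OF xy _ v1I] by blast
    next
      case 4
      show ?thesis
      proof (cases adj)
        case False
        then show ?thesis using via_u[OF xy 4(1) v2I] by blast
      next
        case True
        let ?F = "{v1, v2}"
        have "link Z D v2 v1" using D(9) True by (simp add: Extra_def)
        then have "reach (N - ?F) D v2 v1" using NZ by (intro link_reach) auto
        then have "reach (N - ?F) D x y"
          using pin[OF xy(1) 4(1), of ?F] pout[OF xy(2) 4(2), of ?F] by (auto intro: reach_trans)
        then show ?thesis using tight_route3[of ?F] vN by (simp add: card_insert_if)
      qed
    qed (use miss xy in auto)
  qed
  then show ?thesis using D(2,3) by blast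
qed

lemma undirected_tight_orientation:
  "\<exists>D. orients D M \<and> D \<inter> D\<inverse> = {} \<and> (\<forall>x\<in>V. \<forall>y\<in>V. tight_route D x y)"
  using tight_orientation_one_pendant tight_orientation_two_pendants by meson

end

section \<open>Translation to oriented diameters\<close>

definition dirs :: "'a pre_mixed_graph \<Rightarrow> 'a rel" where
  "dirs G = marcs G \<union> {(x, y). {x, y} \<in> medges G}"

lemma list_rtrancl:
  assumes "p \<noteq> []" "\<And>i. Suc i < length p \<Longrightarrow> (p ! i, p ! Suc i) \<in> R"
  shows "(hd p, last p) \<in> R\<^sup>*"
  using assms
proof (induction p rule: induct_list012)
  case (3 a b q)
  have "(a, b) \<in> R" using 3(4)[of 0] by simp
  moreover have "(hd (b # q), last (b # q)) \<in> R\<^sup>*"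
  proof (rule 3(2))
    show "((b # q) ! i, (b # q) ! Suc i) \<in> R" if "Suc i < length (b # q)" for i
      using 3(4)[of "Suc i"] that by simp
  qed simp
  ultimately show ?case by (auto intro: converse_rtrancl_into_rtrancl)
qed auto

lemma orientable_path_rtrancl: "orientable_path G x p y \<Longrightarrow> (x, y) \<in> (dirs G)\<^sup>*"
  using list_rtrancl[of p "dirs G"] by (auto simp: orientable_path_def dirs_def)

lemma mconnected_rtrancl: "mconnected G \<Longrightarrow> mverts G \<times> mverts G \<subseteq> (dirs G)\<^sup>*"
  using orientable_path_rtrancl unfolding mconnected_def by (metis mem_Sigma_iff subrelI)

lemma mconnected_underlying: "mconnected G \<Longrightarrow> mconnected (underlying G)"
proof -
  have "orientable_path (underlying G) x p y" if "orientable_path G x p y" for x p y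
    using that by (fastforce simp: orientable_path_def underlying_def)
  moreover have "mverts (underlying G) = mverts G" by (simp add: underlying_def)
  ultimately show "mconnected G \<Longrightarrow> mconnected (underlying G)" unfolding mconnected_def by metis
qed

context mixed_graph
begin

lemma dirs_wf: "(x, y) \<in> dirs G \<Longrightarrow> x \<in> mverts G \<and> y \<in> mverts G \<and> x \<noteq> y"
  using marcs_wf medges_wf by (fastforce simp: dirs_def)

lemma dirs_both: "(x, y) \<in> dirs G \<and> (y, x) \<in> dirs G \<longleftrightarrow> {x, y} \<in> medges G"
  using simple_arc_arc simple_edge_arc by (auto simp: dirs_def insert_commute)

lemma dirs_one: "(x, y) \<in> dirs G \<and> (y, x) \<notin> dirs G \<longleftrightarrow> (x, y) \<in> marcs G"
  using simple_arc_arc simple_edge_arc by (auto simp: dirs_def insert_commute)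

lemma bridgeless_detour:
  assumes "bridgeless G" "{x, y} \<in> medges G"
  shows "(x, y) \<in> ((dirs G \<union> (dirs G)\<inverse>) - {(x, y), (y, x)})\<^sup>*"
proof -
  let ?H = "delete_edge {x, y} (underlying G)"
  have "mconnected (underlying G)" using assms by (auto simp: bridgeless_def intro: mconnected_underlying)
  then have "mconnected ?H" using assms by (auto simp: bridgeless_def is_bridge_def)
  moreover have "x \<in> mverts G" "y \<in> mverts G" using assms medges_wf by blast+
  ultimately have "(x, y) \<in> (dirs ?H)\<^sup>*"
    using mconnected_rtrancl[of ?H] by (auto simp: delete_edge_def underlying_def)
  moreover have "dirs ?H \<subseteq> (dirs G \<union> (dirs G)\<inverse>) - {(x, y), (y, x)}"
    by (auto simp: dirs_def delete_edge_def underlying_def doubleton_eq_iff insert_commute)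
  ultimately show ?thesis using rtrancl_mono by blast
qed

end

lemma reach_vwalk:
  assumes "reach Av D x y" "D \<subseteq> V \<times> V" "y \<in> V"
  shows "\<exists>p. vwalk p (with_proj \<lparr>pverts = V, parcs = D\<rparr>) \<and> hd p = x \<and> last p = y \<and> set p \<inter> Av = {}"
proof -
  have y: "y \<notin> Av" by (rule reach_target[OF assms(1)])
  have "(x, y) \<in> (inner Av D)\<^sup>*" using assms(1) by (simp add: reach_def)
  then show ?thesis
  proof (induction rule: converse_rtrancl_induct)
    case base
    then show ?case using y assms(3) by (intro exI[of _ "[y]"]) (auto simp: vwalk_def)
  next
    case (step a b)
    then obtain p where p: "vwalk p (with_proj \<lparr>pverts = V, parcs = D\<rparr>)" "hd p = b" "last p = y"
      "set p \<inter> Av = {}" by blast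
    have "(a, b) \<in> D" "a \<notin> Av" using step(1) by (auto simp: inner_def)
    then show ?case using p assms(2) vwalk_consI[OF p(1), of a]
      by (intro exI[of _ "a # p"]) (auto simp: vwalk_def)
  qed
qed

text \<open>
  An exact count, since the surplus of one side of the bipartition depends only on the sides on
  which the two ends lie.
\<close>

lemma alternating_length:
  assumes "p \<noteq> []" "distinct p" "\<And>x y. (x, y) \<in> set (vwalk_arcs p) \<Longrightarrow> x \<in> A \<longleftrightarrow> y \<notin> A"
  shows "length p + of_bool (hd p \<in> A) = 2 * card (set p \<inter> A) + of_bool (last p \<notin> A)"
  using assms
proof (induction p rule: induct_list012)
  case (3 a b q)
  have IH: "length (b # q) + of_bool (b \<in> A) = 2 * card (set (b # q) \<inter> A) + of_bool (last (b # q) \<notin> A)"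
    using 3(2) 3(4,5) by simp
  have ab: "a \<in> A \<longleftrightarrow> b \<notin> A" using 3(5)[of a b] by simp
  have "card (set (a # b # q) \<inter> A) = of_bool (a \<in> A) + card (set (b # q) \<inter> A)"
    using 3(4) by (auto simp: Int_insert_left)
  then show ?case using IH ab by (cases "a \<in> A") auto
qed auto

context mixed_bipartite_graph
begin

lemma bip_dirs: "(x, y) \<in> dirs G \<Longrightarrow> x \<in> A \<longleftrightarrow> y \<notin> A"
  using edge_across[of x y] partition by (auto simp: dirs_def)

lemma finite_A: "finite A" using finite_mverts partition by simp

lemma mixed_star_dirs:
  assumes "bridgeless G" "u \<in> B"
  shows "mixed_star (mverts G) A (dirs G) u"
proof
  show "mverts G \<times> mverts G \<subseteq> (dirs G)\<^sup>*"
    using mconnected_rtrancl assms by (auto simp: bridgeless_def)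
  show "(x, y) \<in> (dirs G \<union> (dirs G)\<inverse> - {(x, y), (y, x)})\<^sup>*"
    if "(x, y) \<in> dirs G" "(y, x) \<in> dirs G" for x y
    using bridgeless_detour[OF assms(1)] dirs_both that by blast
qed (use finite_mverts dirs_wf bip_dirs partition assms in auto)

lemma short_vpath:
  assumes r: "reach Av D x y" and D: "D \<subseteq> dirs G" and y: "y \<in> mverts G"
  obtains p where "vpath p (with_proj \<lparr>pverts = mverts G, parcs = D\<rparr>)" "hd p = x" "last p = y"
    "vwalk_length p \<le> 2 * card (A - Av) - of_bool (y \<in> A)"
proof -
  let ?D = "with_proj \<lparr>pverts = mverts G, parcs = D\<rparr>"
  have "D \<subseteq> mverts G \<times> mverts G" using D dirs_wf by fast
  from reach_vwalk[OF r this y] obtain q where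
    q: "vwalk q ?D" "hd q = x" "last q = y" "set q \<inter> Av = {}" by blast
  define p where "p = vwalk_to_vpath q"
  have p: "vpath p ?D" "hd p = x" "last p = y"
    using q by (simp_all add: p_def vwalk_to_vpath_vpath vwalk_to_vpath_hd vwalk_to_vpath_last)
  have "set p \<inter> Av = {}" using q(4) vwalk_to_vpath_subset unfolding p_def by fast
  have arcs: "set (vwalk_arcs p) \<subseteq> D" "distinct p" "p \<noteq> []"
    using p(1) by (auto simp: vpath_def vwalk_def)
  have "length p + of_bool (hd p \<in> A) = 2 * card (set p \<inter> A) + of_bool (last p \<notin> A)"
    by (rule alternating_length[OF arcs(3,2)]) (use arcs(1) D bip_dirs in blast)
  moreover have "card (set p \<inter> A) \<le> card (A - Av)"
    using \<open>set p \<inter> Av = {}\<close> finite_A by (intro card_mono) auto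
  ultimately have "vwalk_length p \<le> 2 * card (A - Av) - of_bool (y \<in> A)"
    using p(3) by (cases "y \<in> A"; cases "hd p \<in> A") auto
  then show thesis using that p by blast
qed

lemma oriented_diameter_le:
  assumes D: "orients D (dirs G)" "D \<inter> D\<inverse> = {}"
    and short: "\<And>x y. x \<in> mverts G \<Longrightarrow> y \<in> mverts G \<Longrightarrow>
      \<exists>Av. reach Av D x y \<and> 2 * card (A - Av) - of_bool (y \<in> A) \<le> k"
    and ne: "mverts G \<noteq> {}"
  shows "oriented_diameter G \<le> enat k"
proof -
  define H where "H = \<lparr>pverts = mverts G, parcs = D\<rparr>"
  have DG: "D \<subseteq> dirs G" and DD: "D \<union> D\<inverse> = dirs G \<union> (dirs G)\<inverse>" using D(1) by (auto simp: orients_def)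
  have path: "\<exists>p. vpath p (with_proj H) \<and> hd p = x \<and> last p = y \<and> vwalk_length p \<le> k"
    if xy: "x \<in> mverts G" "y \<in> mverts G" for x y
  proof -
    obtain Av where "reach Av D x y" "2 * card (A - Av) - of_bool (y \<in> A) \<le> k" using short[OF xy] by blast
    then show ?thesis using short_vpath[OF _ DG xy(2), of Av x] unfolding H_def by (metis le_trans)
  qed
  have "orientation G H"
    unfolding orientation_def
  proof (intro conjI allI impI)
    show "pverts H = mverts G" by (simp add: H_def)
    have "(x, y) \<in> D" if "(x, y) \<in> marcs G" for x y
      using that dirs_one[of x y] DG DD by blast
    then show "marcs G \<subseteq> parcs H" by (auto simp: H_def)
    show "parcs H \<subseteq> marcs G \<union> {(x, y). {x, y} \<in> medges G}" using DG by (simp add: H_def dirs_def)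
    show "((x, y) \<in> parcs H) = ((y, x) \<notin> parcs H)" if "{x, y} \<in> medges G" for x y
    proof -
      have "(x, y) \<in> D \<union> D\<inverse>" using that unfolding DD by (auto simp: dirs_def)
      then show ?thesis using D(2) by (auto simp: H_def)
    qed
  qed
  moreover have "strongly_connected (with_proj H)"
  proof -
    interpret pair_wf_digraph H
      by standard (use DG dirs_wf in \<open>auto simp: H_def\<close>)
    show ?thesis
    proof (rule strongly_connectedI)
      show "verts (with_proj H) \<noteq> {}" using ne by (simp add: H_def)
      show "x \<rightarrow>\<^sup>*\<^bsub>with_proj H\<^esub> y" if "x \<in> verts (with_proj H)" "y \<in> verts (with_proj H)" for x y
      proof -
        have "x \<in> mverts G" "y \<in> mverts G" using that by (simp_all add: H_def)
        then show ?thesis unfolding reachable_vpath_conv using path by blast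
      qed
    qed
  qed
  ultimately have "H \<in> {D. strong_orientation G D}" by (simp add: strong_orientation_def)
  then have "oriented_diameter G \<le> digraph_diameter (with_proj H)"
    unfolding oriented_diameter_def by (rule INF_lower)
  also have "\<dots> \<le> enat k"
    unfolding digraph_diameter_def
  proof (intro SUP_least)
    fix x y assume "x \<in> verts (with_proj H)" "y \<in> verts (with_proj H)"
    then obtain p where "vpath p (with_proj H)" "hd p = x" "last p = y" "vwalk_length p \<le> k"
      using path[of x y] by (auto simp: H_def)
    then show "digraph_dist (with_proj H) x y \<le> enat k"
      unfolding digraph_dist_def by (intro INF_lower2[of p]) auto
  qed
  finally show ?thesis .
qed

lemma bounded_orientation_diameter:
  assumes "bounded_orientation (mverts G) A (dirs G) m" "mverts G \<noteq> {}"
  shows "oriented_diameter G \<le> enat (2 * m)"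
proof -
  obtain D where D: "orients D (dirs G)" "D \<inter> D\<inverse> = {}"
    "\<forall>x\<in>mverts G. \<forall>y\<in>mverts G. \<exists>Av. reach Av D x y \<and> card (A - Av) \<le> m"
    using assms(1) unfolding bounded_orientation_def by blast
  show ?thesis
  proof (rule oriented_diameter_le[OF D(1,2) _ assms(2)])
    fix x y assume "x \<in> mverts G" "y \<in> mverts G"
    then obtain Av where "reach Av D x y" "card (A - Av) \<le> m" using D(3) by blast
    then show "\<exists>Av. reach Av D x y \<and> 2 * card (A - Av) - of_bool (y \<in> A) \<le> 2 * m"
      by (intro exI[of _ Av]) auto
  qed
qed

end

lemma mdeg_out_eq: "mdeg_out G u = card {v. (u, v) \<in> marcs G}"
proof -
  have "out_arcs (with_proj (directed_part G)) u = Pair u ` {v. (u, v) \<in> marcs G}"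
    by (auto simp: out_arcs_def directed_part_def)
  then show ?thesis by (simp add: mdeg_out_def out_degree_def card_image inj_on_def)
qed

lemma mdeg_in_eq: "mdeg_in G u = card {v. (v, u) \<in> marcs G}"
proof -
  have "in_arcs (with_proj (directed_part G)) u = (\<lambda>v. (v, u)) ` {v. (v, u) \<in> marcs G}"
    by (auto simp: in_arcs_def directed_part_def)
  then show ?thesis by (simp add: mdeg_in_def in_degree_def card_image inj_on_def)
qed

lemma (in mixed_graph) mdeg_und_eq: "mdeg_und G u = card {v. {u, v} \<in> medges G}"
proof -
  have "{e \<in> medges G. u \<in> e} = (\<lambda>v. {u, v}) ` {v. {u, v} \<in> medges G}"
  proof (intro set_eqI iffI)
    fix e assume "e \<in> {e \<in> medges G. u \<in> e}"
    then have "e \<in> medges G" "u \<in> e" "card e = 2" using medges_wf by auto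
    then show "e \<in> (\<lambda>v. {u, v}) ` {v. {u, v} \<in> medges G}"
      by (auto simp: card_2_iff insert_commute)
  qed auto
  moreover have "inj_on (\<lambda>v. {u, v}) {v. {u, v} \<in> medges G}"
    by (auto simp: inj_on_def doubleton_eq_iff)
  ultimately show ?thesis by (simp add: mdeg_und_def card_image)
qed

theorem theorem1p5:
  fixes G :: "'a pre_mixed_graph" and A B :: "'a set" and u :: 'a and n :: nat
  assumes "mixed_bipartite_graph G A B"
    and "bridgeless G"
    and "card (mverts G) = n"
    and "u \<in> B"
  shows "(marcs G = {} \<longrightarrow>
            oriented_diameter G \<le> enat (2 * (card A - mdeg G u) + 7)) \<and>
         (mdeg_out G u + mdeg_in G u \<ge> 2 \<longrightarrow>
            oriented_diameter G \<le> enat (2 * (card A - mdeg_und G u) + 8)) \<and>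
         (\<not> marcs G = {} \<and> \<not> mdeg_out G u + mdeg_in G u \<ge> 2 \<longrightarrow>
            oriented_diameter G \<le> enat (2 * (card A - mdeg_und G u) + 10))"
proof -
  interpret mixed_bipartite_graph G A B by (rule assms)
  interpret S: mixed_star "mverts G" A "dirs G" u by (rule mixed_star_dirs[OF assms(2,4)])
  have ne: "mverts G \<noteq> {}" using assms(4) partition by auto
  have N: "mdeg_und G u = card S.N"
    unfolding mdeg_und_eq S.N_def using dirs_both by simp
  have Out: "mdeg_out G u = card S.Out" and In: "mdeg_in G u = card S.In"
    unfolding mdeg_out_eq mdeg_in_eq S.Out_def S.In_def using dirs_one by simp_all
  show ?thesis
  proof (intro conjI impI)
    assume e: "marcs G = {}"
    interpret U: undirected_star "mverts G" A "dirs G" u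
      by standard (use e in \<open>auto simp: dirs_def insert_commute\<close>)
    obtain D where D: "orients D (dirs G)" "D \<inter> D\<inverse> = {}"
      "\<forall>x\<in>mverts G. \<forall>y\<in>mverts G. U.tight_route D x y"
      using U.undirected_tight_orientation by blast
    show "oriented_diameter G \<le> enat (2 * (card A - mdeg G u) + 7)"
    proof (rule oriented_diameter_le[OF D(1,2) _ ne])
      fix x y assume "x \<in> mverts G" "y \<in> mverts G"
      then obtain Av where "reach Av D x y" "card (A - Av) \<le> card A - card S.N + 3 \<or>
          y \<in> A \<and> card (A - Av) \<le> card A - card S.N + 4"
        using D(3) unfolding U.tight_route_def by blast
      then show "\<exists>Av. reach Av D x y \<and>
          2 * card (A - Av) - of_bool (y \<in> A) \<le> 2 * (card A - mdeg G u) + 7"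
        unfolding mdeg_eq_mdeg_und[OF e] N by (intro exI[of _ Av]) auto
    qed
  next
    assume "2 \<le> mdeg_out G u + mdeg_in G u"
    then show "oriented_diameter G \<le> enat (2 * (card A - mdeg_und G u) + 8)"
      using bounded_orientation_diameter[OF S.bounded_orientation_four ne] by (simp add: N Out In)
  next
    show "oriented_diameter G \<le> enat (2 * (card A - mdeg_und G u) + 10)"
      using bounded_orientation_diameter[OF S.bounded_orientation_five ne] by (simp add: N)
  qed
qed

end
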